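(* Let $N=r+1$, $q$ a parameter, and for $i\in[1,N]$ let $\Gamma_i$ be the operator $(\Gamma_if)(x_1,\dots,x_N)=f(x_1,\dots,x_{i-1},qx_i,x_{i+1},\dots,x_N)$. For $\alpha\in[1,N]$ and $n\in\mathbb{Z}$ define the difference operator $$M_{\alpha,n}=\sum_{I\subset[1,N],\,|I|=\alpha}x_I^{\,n}\prod_{i\in I,\ j\notin I}\frac{x_i}{x_i-x_j}\,\Gamma_I,\qquad x_I=\prod_{i\in I}x_i,\ \Gamma_I=\prod_{i\in I}\Gamma_i,$$ and set $M_{0,n}=1$. Then $M_{N,n}=A^n\Delta$ with $A=x_1\cdots x_N$, $\Delta=\Gamma_1\cdots\Gamma_N$, and the operators satisfy the quantum ("M-system") relations $$M_{\alpha,n}M_{\beta,n+1}=q^{\min(\alpha,\beta)}M_{\beta,n+1}M_{\alpha,n}\quad(\alpha,\beta\in[1,r],\ n\in\mathbb{Z}),$$ $$q^{\alpha}M_{\alpha,n+1}M_{\alpha,n-1}=(M_{\alpha,n})^2-M_{\alpha+1,n}M_{\alpha-1,n}\quad(\alpha\in[1,r],\ n\in\mathbb{Z}).$$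
   Context: The operators act on the ring of symmetric functions (symmetric rational/Laurent polynomial functions) in $x_1,\dots,x_N$. This M-system is a rescaled form of the $A_r$ quantum Q-system, which quantizes the Q-system $Q_{\alpha,n+1}Q_{\alpha,n-1}=Q_{\alpha,n}^2-Q_{\alpha+1,n}Q_{\alpha-1,n}$ satisfied by Kirillov–Reshetikhin characters. *)

theory Defs
  imports Main "HOL-Combinatorics.Permutations"
begin

text \<open>Points are x :: nat => 'a; the variables x_1..x_N are the coordinates 0..N-1.
  Functions of the variables are f :: (nat => 'a) => 'a; operators map such functions to such functions.\<close>

definition qshift :: "'a::field \<Rightarrow> nat set \<Rightarrow> (nat \<Rightarrow> 'a) \<Rightarrow> (nat \<Rightarrow> 'a)" where
  "qshift q I x = (\<lambda>j. if j \<in> I then q * x j else x j)"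

definition Gamma :: "'a::field \<Rightarrow> nat set \<Rightarrow> ((nat \<Rightarrow> 'a) \<Rightarrow> 'a) \<Rightarrow> ((nat \<Rightarrow> 'a) \<Rightarrow> 'a)" where
  "Gamma q I f = (\<lambda>x. f (qshift q I x))"

definition Mop :: "'a::field \<Rightarrow> nat \<Rightarrow> nat \<Rightarrow> int \<Rightarrow> ((nat \<Rightarrow> 'a) \<Rightarrow> 'a) \<Rightarrow> ((nat \<Rightarrow> 'a) \<Rightarrow> 'a)" where
  "Mop q N \<alpha> n f = (if \<alpha> = 0 then f else
     (\<lambda>x. \<Sum>I\<in>{I. I \<subseteq> {..<N} \<and> card I = \<alpha>}.
        (\<Prod>i\<in>I. x i) powi n * (\<Prod>i\<in>I. \<Prod>j\<in>{..<N} - I. x i / (x i - x j)) * Gamma q I f x))"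

definition symmetric_fun :: "nat \<Rightarrow> ((nat \<Rightarrow> 'a) \<Rightarrow> 'b) \<Rightarrow> bool" where
  "symmetric_fun N f = (\<forall>\<sigma>. \<sigma> permutes {..<N} \<longrightarrow> (\<forall>x. f (x \<circ> \<sigma>) = f x))"

end

theory Submission
  imports Defs "HOL-Computational_Algebra.Polynomial_Factorial"
begin

text \<open>
  Expand the composite of two operators as a sum over pairs \<open>(I, J)\<close> and group the pairs by
  \<open>K = I \<inter> J\<close> and by the symmetric difference \<open>L\<close>. The shift of \<open>f\<close> depends only on \<open>(K, L)\<close>, and
  with \<open>A = I - J\<close>, \<open>B = J - I\<close> the coefficient is a factor depending only on \<open>(K, L)\<close> times
  \<open>x_A^n x_B^m \<Prod>_{a \<in> A, b \<in> B} x_a x_b / ((x_a - x_b) (x_b - q x_a))\<close>. Both relations thus reduce to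
  the vanishing of a weighted sum over the splittings \<open>L = A \<union> B\<close>.

  For generic \<open>q\<close> that sum vanishes by induction on \<open>L\<close>. As a function of one variable \<open>t\<close>, multiplied
  by its common denominator and divided by \<open>t\<close>, it is a polynomial of degree less than \<open>3 (|L| - 1)\<close>.
  For every other variable \<open>x_l\<close> it has the roots \<open>x_l\<close> (exchanging \<open>t\<close> and \<open>x_l\<close> changes the sign of
  the residue) and \<open>q x_l\<close>, \<open>x_l / q\<close> (the residue there is the same sum for \<open>L\<close> without both
  variables), so it is zero. Arbitrary \<open>q\<close> is reached by specialising an indeterminate.
\<close>

section \<open>Sums over splittings\<close>

text \<open>The contribution of one pair (a, b) with a in A = I - J and b in B = J - I: the factor a
  / (a - b) comes from the left operator, and b / (b - q a) comes from the right one after its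
  variable a has been shifted.\<close>

definition omega :: "'a::field \<Rightarrow> 'a \<Rightarrow> 'a \<Rightarrow> 'a" where
  "omega q a b = a * b / ((a - b) * (b - q * a))"

definition pairing :: "'a::field \<Rightarrow> ('i \<Rightarrow> 'a) \<Rightarrow> 'i set \<Rightarrow> 'i set \<Rightarrow> 'a" where
  "pairing q x A B = (\<Prod>i\<in>A. \<Prod>j\<in>B. omega q (x i) (x j))"

text \<open>The weight sees only |A| and the two products over A and L - A. Fixing the side of some
  variables therefore yields a sum of the same kind with another weight, which is what the induction
  on \<open>L\<close> needs.\<close>

definition splitsum :: "(nat \<Rightarrow> 'a \<Rightarrow> 'a \<Rightarrow> 'a) \<Rightarrow> 'a::field \<Rightarrow> ('i \<Rightarrow> 'a) \<Rightarrow> 'i set \<Rightarrow> 'a" where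
  "splitsum W q x L = (\<Sum>A\<in>Pow L. W (card A) (prod x A) (prod x (L - A)) * pairing q x A (L - A))"

lemma pairing_insert_left:
  "finite A \<Longrightarrow> m \<notin> A \<Longrightarrow> pairing q x (insert m A) B = (\<Prod>j\<in>B. omega q (x m) (x j)) * pairing q x A B"
  by (simp add: pairing_def)

lemma pairing_insert_right:
  "finite B \<Longrightarrow> m \<notin> B \<Longrightarrow> pairing q x A (insert m B) = (\<Prod>i\<in>A. omega q (x i) (x m)) * pairing q x A B"
  by (simp add: pairing_def prod.distrib)

lemma sum_Pow_insert:
  fixes f :: "'i set \<Rightarrow> 'b::comm_monoid_add"
  assumes "finite L" "m \<notin> L"
  shows "(\<Sum>A\<in>Pow (insert m L). f A) = (\<Sum>A\<in>Pow L. f (insert m A) + f A)"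
proof -
  have "inj_on (insert m) (Pow L)" using assms(2) by (auto simp: inj_on_def)
  moreover have "Pow L \<inter> insert m ` Pow L = {}" using assms(2) by auto
  ultimately show ?thesis using assms(1)
    by (simp add: Pow_insert sum.union_disjoint sum.reindex sum.distrib add.commute)
qed

section \<open>Polynomial functions away from zero\<close>

text \<open>Only \<open>t \<noteq> 0\<close> is constrained, so that expressions such as \<open>t ^ k / t\<close> qualify although \<open>x / 0 = 0\<close>.\<close>

definition poly_off_zero :: "nat \<Rightarrow> ('a::field \<Rightarrow> 'a) \<Rightarrow> bool" where
  "poly_off_zero n g \<longleftrightarrow> (\<exists>p. (p = 0 \<or> degree p < n) \<and> (\<forall>t. t \<noteq> 0 \<longrightarrow> g t = poly p t))"

lemma poly_off_zero_add:
  assumes "poly_off_zero n f" "poly_off_zero n g"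
  shows "poly_off_zero n (\<lambda>t. f t + g t)"
proof -
  obtain p r where "p = 0 \<or> degree p < n" "\<forall>t. t \<noteq> 0 \<longrightarrow> f t = poly p t"
    "r = 0 \<or> degree r < n" "\<forall>t. t \<noteq> 0 \<longrightarrow> g t = poly r t"
    using assms unfolding poly_off_zero_def by blast
  thus ?thesis unfolding poly_off_zero_def
    by (intro exI[of _ "p + r"]) (auto simp: degree_add_less)
qed

lemma poly_off_zero_zero [simp]: "poly_off_zero n (\<lambda>t. 0)"
  unfolding poly_off_zero_def by (intro exI[of _ 0]) auto

lemma poly_off_zero_sum:
  "(\<And>i. i \<in> S \<Longrightarrow> poly_off_zero n (f i)) \<Longrightarrow> poly_off_zero n (\<lambda>t. \<Sum>i\<in>S. f i t)"
  by (induction S rule: infinite_finite_induct) (auto intro: poly_off_zero_add)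

lemma poly_off_zero_mult_poly:
  assumes "poly_off_zero n f" "degree p \<le> k"
  shows "poly_off_zero (n + k) (\<lambda>t. f t * poly p t)"
proof -
  obtain r where "r = 0 \<or> degree r < n" "\<forall>t. t \<noteq> 0 \<longrightarrow> f t = poly r t"
    using assms unfolding poly_off_zero_def by blast
  thus ?thesis unfolding poly_off_zero_def using assms(2)
    by (intro exI[of _ "r * p"]) (auto intro: le_less_trans[OF degree_mult_le])
qed

lemma poly_off_zero_cong:
  "poly_off_zero n f \<Longrightarrow> (\<And>t. t \<noteq> 0 \<Longrightarrow> g t = f t) \<Longrightarrow> poly_off_zero n g"
  unfolding poly_off_zero_def by metis

lemma poly_off_zero_monom: "k < n \<Longrightarrow> poly_off_zero n (\<lambda>t. c * t ^ k)"
  unfolding poly_off_zero_def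
  by (intro exI[of _ "monom c k"]) (auto simp: poly_monom intro: le_less_trans[OF degree_monom_le])

text \<open>A nonzero polynomial of degree less than n has fewer than n roots. The roots in
  \<open>R\<close> and the point \<open>s\<close> must avoid 0, where nothing ties the function to
  the polynomial.\<close>

lemma poly_off_zero_eq_0:
  assumes "poly_off_zero n g" "finite R" "n \<le> card R" "0 \<notin> R" "\<And>t. t \<in> R \<Longrightarrow> g t = 0" "s \<noteq> 0"
  shows "g s = 0"
proof -
  obtain p where p: "p = 0 \<or> degree p < n" "\<forall>t. t \<noteq> 0 \<longrightarrow> g t = poly p t"
    using assms(1) unfolding poly_off_zero_def by blast
  have "p = 0"
  proof (rule ccontr)
    assume "p \<noteq> 0"
    have "R \<subseteq> {t. poly p t = 0}"
    proof
      fix t assume t: "t \<in> R"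
      have "t \<noteq> 0" using t assms(4) by blast
      hence "poly p t = 0" using p(2) assms(5)[OF t] by simp
      thus "t \<in> {t. poly p t = 0}" by simp
    qed
    with poly_roots_finite[OF \<open>p \<noteq> 0\<close>] have "card R \<le> card {t. poly p t = 0}"
      by (rule card_mono)
    also have "\<dots> \<le> degree p" using \<open>p \<noteq> 0\<close> by (rule card_poly_roots_bound)
    finally show False using p(1) \<open>p \<noteq> 0\<close> assms(3) by simp
  qed
  thus ?thesis using p(2) assms(6) by simp
qed

section \<open>Eliminating one variable\<close>

text \<open>The last condition makes the three families of roots x_l, q x_l and x_l / q pairwise
  disjoint. It includes i = j, so for nonempty \<open>L\<close> it also excludes q = 1 and q^2 =
  1.\<close>

definition generic_points :: "'a::field \<Rightarrow> ('i \<Rightarrow> 'a) \<Rightarrow> 'i set \<Rightarrow> bool" where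
  "generic_points q x L \<longleftrightarrow> q \<noteq> 0 \<and> inj_on x L \<and> 0 \<notin> x ` L \<and>
     (\<forall>i\<in>L. \<forall>j\<in>L. x i \<noteq> q * x j \<and> x i \<noteq> q^2 * x j)"

lemma generic_points_subset: "generic_points q x L \<Longrightarrow> M \<subseteq> L \<Longrightarrow> generic_points q x M"
  unfolding generic_points_def by (blast intro: inj_on_subset)

text \<open>\<open>den q a t\<close> is the common denominator of \<open>omega q t a\<close> and \<open>omega q a t\<close>; the numerators
  over it are \<open>numA q a t\<close> and \<open>numB q a t\<close>.\<close>

definition den :: "'a::field \<Rightarrow> 'a \<Rightarrow> 'a \<Rightarrow> 'a" where
  "den q a t = (t - a) * (t - q * a) * (a - q * t)"
definition numA :: "'a::field \<Rightarrow> 'a \<Rightarrow> 'a \<Rightarrow> 'a" where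
  "numA q b t = t * b * (t - q * b)"
definition numB :: "'a::field \<Rightarrow> 'a \<Rightarrow> 'a \<Rightarrow> 'a" where
  "numB q a t = - (a * t * (a - q * t))"

text \<open>The sum over splittings of \<open>L\<close> together with one more variable of value t,
  multiplied by all \<open>den q (x l) t\<close>. The first summand has t on the side of A, the
  second has it on the other side. In this form t may also take the values at which
  \<open>omega\<close> has a pole.\<close>

definition cleared ::
    "(nat \<Rightarrow> 'a \<Rightarrow> 'a \<Rightarrow> 'a) \<Rightarrow> 'a::field \<Rightarrow> ('i \<Rightarrow> 'a) \<Rightarrow> 'i set \<Rightarrow> 'a \<Rightarrow> 'a" where
  "cleared W q x L t = (\<Sum>A\<in>Pow L. pairing q x A (L - A) *
     (W (Suc (card A)) (t * prod x A) (prod x (L - A)) *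
        ((\<Prod>b\<in>L - A. numA q (x b) t) * (\<Prod>a\<in>A. den q (x a) t)) +
      W (card A) (prod x A) (t * prod x (L - A)) *
        ((\<Prod>a\<in>A. numB q (x a) t) * (\<Prod>b\<in>L - A. den q (x b) t))))"

lemma numA_omega: "t \<noteq> b \<Longrightarrow> b \<noteq> q * t \<Longrightarrow> omega q t b * den q b t = numA q b t"
  unfolding omega_def den_def numA_def by (simp add: divide_simps)

lemma numB_omega: "t \<noteq> a \<Longrightarrow> t \<noteq> q * a \<Longrightarrow> omega q a t * den q a t = numB q a t"
  unfolding omega_def den_def numB_def by (simp add: divide_simps) (simp add: algebra_simps)

lemma prod_mult_cong:
  fixes f g h :: "'i \<Rightarrow> 'b::comm_monoid_mult"
  assumes "\<And>i. i \<in> S \<Longrightarrow> f i * g i = h i"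
  shows "prod f S * prod g S = prod h S"
  using assms by (simp add: prod.distrib[symmetric])

text \<open>Genericity keeps every denominator nonzero. The factors \<open>den\<close> that belong
  to variables opposite to the new one turn its \<open>omega\<close> factors into
  \<open>numA\<close> or \<open>numB\<close>; those of variables on its own side remain.\<close>

lemma splitsum_insert_cleared:
  assumes fin: "finite L" and m: "m \<notin> L" and gen: "generic_points q x (insert m L)"
  shows "splitsum W q x (insert m L) * (\<Prod>l\<in>L. den q (x l) (x m)) = cleared W q x L (x m)"
  unfolding splitsum_def cleared_def sum_Pow_insert[OF fin m] sum_distrib_right
proof (rule sum.cong[OF refl])
  fix A assume A: "A \<in> Pow L"
  hence fA: "finite A" and fB: "finite (L - A)" and mA: "m \<notin> A"
    using fin m by (auto intro: finite_subset)
  have i1: "insert m L - insert m A = L - A" using m by auto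
  have i2: "insert m L - A = insert m (L - A)" using mA by auto
  have d: "(\<Prod>l\<in>L. den q (x l) (x m)) = (\<Prod>l\<in>L - A. den q (x l) (x m)) * (\<Prod>l\<in>A. den q (x l) (x m))"
    using A fin by (intro prod.subset_diff) auto
  have "x m \<noteq> x l" "x l \<noteq> q * x m" "x m \<noteq> q * x l" if "l \<in> L" for l
    using that gen m unfolding generic_points_def inj_on_def by auto
  hence a: "(\<Prod>j\<in>L - A. omega q (x m) (x j)) * (\<Prod>l\<in>L - A. den q (x l) (x m)) = (\<Prod>l\<in>L - A. numA q (x l) (x m))"
    and b: "(\<Prod>j\<in>A. omega q (x j) (x m)) * (\<Prod>l\<in>A. den q (x l) (x m)) = (\<Prod>l\<in>A. numB q (x l) (x m))"
    using A by (auto intro!: prod_mult_cong numA_omega numB_omega)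
  show "(W (card (insert m A)) (prod x (insert m A)) (prod x (insert m L - insert m A)) *
          pairing q x (insert m A) (insert m L - insert m A) +
          W (card A) (prod x A) (prod x (insert m L - A)) * pairing q x A (insert m L - A)) *
         (\<Prod>l\<in>L. den q (x l) (x m)) =
         pairing q x A (L - A) *
     (W (Suc (card A)) (x m * prod x A) (prod x (L - A)) *
        ((\<Prod>b\<in>L - A. numA q (x b) (x m)) * (\<Prod>a\<in>A. den q (x a) (x m))) +
      W (card A) (prod x A) (x m * prod x (L - A)) *
        ((\<Prod>a\<in>A. numB q (x a) (x m)) * (\<Prod>b\<in>L - A. den q (x b) (x m))))"
    unfolding i1 i2 using fA fB mA m
    by (simp add: pairing_insert_left pairing_insert_right d a[symmetric] b[symmetric] algebra_simps)
qed

section \<open>Degree of the cleared sum\<close>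

lemma poly_prod_degree_le:
  assumes "\<And>i. i \<in> S \<Longrightarrow> degree (p i) \<le> k"
  shows "degree (\<Prod>i\<in>S. p i) \<le> k * card S"
  using assms
proof (induction S rule: infinite_finite_induct)
  case (insert i S)
  have "degree (p i * prod p S) \<le> degree (p i) + degree (prod p S)" by (rule degree_mult_le)
  also have "\<dots> \<le> k + k * card S" using insert by (intro add_mono) auto
  finally show ?case using insert by simp
qed auto

text \<open>Write B = L - A. With t on the side of A, each of the |B| factors \<open>numA\<close> is
  t times a linear polynomial and each of the |A| factors \<open>den\<close> is cubic. The powers of
  t go with the weight, which then has degree below 2|B| by assumption, and the rest has degree at
  most |B| + 3|A|; together the degree is below 3|L|. With t on the other side, A and B change
  roles.\<close>

lemma poly_off_zero_cleared:
  fixes x :: "'i \<Rightarrow> 'a::field"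
  assumes fin: "finite L"
    and c1: "\<And>A. A \<subseteq> L \<Longrightarrow> poly_off_zero (2 * card (L - A))
              (\<lambda>t. W (Suc (card A)) (t * prod x A) (prod x (L - A)) * t ^ card (L - A) / t)"
    and c2: "\<And>A. A \<subseteq> L \<Longrightarrow> poly_off_zero (2 * card A)
              (\<lambda>t. W (card A) (prod x A) (t * prod x (L - A)) * t ^ card A / t)"
  shows "poly_off_zero (3 * card L) (\<lambda>t. cleared W q x L t / t)"
  unfolding cleared_def sum_divide_distrib
proof (rule poly_off_zero_sum)
  fix A assume "A \<in> Pow L"
  hence A: "A \<subseteq> L" by simp
  let ?B = "L - A"
  let ?a = "card A" and ?b = "card (L - A)"
  have cL: "card L = ?a + ?b" using A fin
    by (metis add.commute card_Diff_subset card_mono finite_subset le_add_diff_inverse2)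
  define D where "D = (\<lambda>a. [:-a, 1:] * [:-(q*a), 1:] * [:a, -q:])"
  have dD: "degree (D a) \<le> 3" for a
  proof -
    have "degree (D a) \<le> degree ([:-a, 1:] * [:-(q*a), 1:]) + degree [:a, -q:]"
      unfolding D_def by (rule degree_mult_le)
    also have "\<dots> \<le> (degree [:-a, 1:] + degree [:-(q*a), 1:]) + degree [:a, -q:]"
      by (intro add_mono degree_mult_le order_refl)
    finally show ?thesis by (simp split: if_splits)
  qed
  have D: "den q a t = poly (D a) t" for a t by (simp add: den_def D_def algebra_simps)
  \<comment> \<open>\<open>E\<close> and \<open>F\<close> are the linear cofactors of t in
    \<open>numA\<close> and \<open>numB\<close>; \<open>G\<close> and \<open>H\<close> below collect
    everything in the two summands except the weight and the split-off powers of t.\<close>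
  define E where "E = (\<lambda>b. [:- (q * b * b), b:])"
  have E: "numA q b t = t * poly (E b) t" for b t by (simp add: numA_def E_def algebra_simps)
  define F where "F = (\<lambda>a. [:- (a * a), q * a:])"
  have F: "numB q a t = t * poly (F a) t" for a t by (simp add: numB_def F_def algebra_simps)
  define G where "G = [:pairing q x A ?B:] * ((\<Prod>b\<in>?B. E (x b)) * (\<Prod>a\<in>A. D (x a)))"
  define H where "H = [:pairing q x A ?B:] * ((\<Prod>a\<in>A. F (x a)) * (\<Prod>b\<in>?B. D (x b)))"
  have dE: "degree (E b) \<le> 1" for b by (simp add: E_def)
  have dF: "degree (F b) \<le> 1" for b by (simp add: F_def)
  have dG: "degree G \<le> 1 * ?b + 3 * ?a"
    unfolding G_def
    by (rule order_trans[OF degree_mult_le], rule order_trans[OF add_mono[OF order_refl degree_mult_le]])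
       (use poly_prod_degree_le[of ?B "\<lambda>b. E (x b)", OF dE] poly_prod_degree_le[of A "\<lambda>b. D (x b)", OF dD] in
         \<open>simp del: One_nat_def add: add_mono poly_prod_degree_le dE dD\<close>)
  have dH: "degree H \<le> 1 * ?a + 3 * ?b"
    unfolding H_def
    by (rule order_trans[OF degree_mult_le], rule order_trans[OF add_mono[OF order_refl degree_mult_le]])
       (use poly_prod_degree_le[of A "\<lambda>b. F (x b)", OF dF] poly_prod_degree_le[of ?B "\<lambda>b. D (x b)", OF dD] in
         \<open>simp del: One_nat_def add: add_mono poly_prod_degree_le dF dD\<close>)
  have "2 * ?b + (1 * ?b + 3 * ?a) = 3 * card L" "2 * ?a + (1 * ?a + 3 * ?b) = 3 * card L"
    using cL by auto
  note degree_sums = this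
  have h1: "poly_off_zero (3 * card L)
          (\<lambda>t. W (Suc ?a) (t * prod x A) (prod x ?B) * t ^ ?b / t * poly G t)"
    using poly_off_zero_mult_poly[OF c1[OF A] dG] unfolding degree_sums .
  have h2: "poly_off_zero (3 * card L)
          (\<lambda>t. W ?a (prod x A) (t * prod x ?B) * t ^ ?a / t * poly H t)"
    using poly_off_zero_mult_poly[OF c2[OF A] dH] unfolding degree_sums .
  have "poly_off_zero (3 * card L)
          (\<lambda>t. W (Suc ?a) (t * prod x A) (prod x ?B) * t ^ ?b / t * poly G t
             + W ?a (prod x A) (t * prod x ?B) * t ^ ?a / t * poly H t)"
    by (rule poly_off_zero_add[OF h1 h2])
  thus "poly_off_zero (3 * card L) (\<lambda>t. pairing q x A (L - A) *
     (W (Suc (card A)) (t * prod x A) (prod x (L - A)) *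
        ((\<Prod>b\<in>L - A. numA q (x b) t) * (\<Prod>a\<in>A. den q (x a) t)) +
      W (card A) (prod x A) (t * prod x (L - A)) *
        ((\<Prod>a\<in>A. numB q (x a) t) * (\<Prod>b\<in>L - A. den q (x b) t))) / t)"
  proof (rule poly_off_zero_cong)
    fix t :: 'a
    have "(\<Prod>b\<in>?B. numA q (x b) t) = t ^ ?b * poly (\<Prod>b\<in>?B. E (x b)) t"
      "(\<Prod>a\<in>A. numB q (x a) t) = t ^ ?a * poly (\<Prod>a\<in>A. F (x a)) t"
      "(\<Prod>a\<in>A. den q (x a) t) = poly (\<Prod>a\<in>A. D (x a)) t"
      "(\<Prod>b\<in>?B. den q (x b) t) = poly (\<Prod>b\<in>?B. D (x b)) t"
      by (simp_all add: D E F prod.distrib poly_prod)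
    note products = this
    show "pairing q x A (L - A) *
     (W (Suc (card A)) (t * prod x A) (prod x (L - A)) *
        ((\<Prod>b\<in>L - A. numA q (x b) t) * (\<Prod>a\<in>A. den q (x a) t)) +
      W (card A) (prod x A) (t * prod x (L - A)) *
        ((\<Prod>a\<in>A. numB q (x a) t) * (\<Prod>b\<in>L - A. den q (x b) t))) / t =
      W (Suc ?a) (t * prod x A) (prod x ?B) * t ^ ?b / t * poly G t
             + W ?a (prod x A) (t * prod x ?B) * t ^ ?a / t * poly H t"
      unfolding products G_def H_def poly_mult by (cases "t = 0") (simp_all add: divide_simps, simp add: algebra_simps)
  qed
qed

section \<open>Roots of the cleared sum\<close>

text \<open>At t = x_l the factor \<open>den q (x l) t\<close> vanishes, so only terms with t and
  x_l on opposite sides survive. Exchanging the two pairs off these terms: the weights agree because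
  the values are equal, and the coefficients are opposite.\<close>

lemma cleared_root_equal:
  assumes fin: "finite L" and l: "l \<in> L" and gen: "generic_points q x L"
  shows "cleared W q x L (x l) = 0"
proof -
  define M where "M = L - {l}"
  have L: "L = insert l M" and lM: "l \<notin> M" and fM: "finite M" using l fin by (auto simp: M_def)
  have d0: "den q (x l) (x l) = 0" by (simp add: den_def)
  show ?thesis unfolding cleared_def L sum_Pow_insert[OF fM lM]
  proof (rule sum.neutral, rule ballI)
    fix A assume A: "A \<in> Pow M"
    hence fA: "finite A" and fB: "finite (M - A)" and lA: "l \<notin> A"
      using fM lM by (auto intro: finite_subset)
    have i1: "insert l M - insert l A = M - A" using lM by auto
    have i2: "insert l M - A = insert l (M - A)" using lA by auto
    have "x l \<noteq> x j" "x j \<noteq> q * x l" "x l \<noteq> q * x j" if "j \<in> M" for j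
      using that gen lM unfolding generic_points_def inj_on_def L by auto
    hence a: "(\<Prod>j\<in>M - A. numA q (x j) (x l)) = (\<Prod>j\<in>M - A. omega q (x l) (x j)) * (\<Prod>j\<in>M - A. den q (x j) (x l))"
      and b: "(\<Prod>j\<in>A. numB q (x j) (x l)) = (\<Prod>j\<in>A. omega q (x j) (x l)) * (\<Prod>j\<in>A. den q (x j) (x l))"
      using A by (auto intro!: prod_mult_cong[symmetric] numA_omega numB_omega)
    \<comment> \<open>This sign is what makes the two surviving terms cancel.\<close>
    have ab: "numA q (x l) (x l) = - numB q (x l) (x l)" by (simp add: numA_def numB_def)
    show "pairing q x (insert l A) (insert l M - insert l A) *
     (W (Suc (card (insert l A))) (x l * prod x (insert l A)) (prod x (insert l M - insert l A)) *
        ((\<Prod>b\<in>insert l M - insert l A. numA q (x b) (x l)) * (\<Prod>a\<in>insert l A. den q (x a) (x l))) +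
      W (card (insert l A)) (prod x (insert l A)) (x l * prod x (insert l M - insert l A)) *
        ((\<Prod>a\<in>insert l A. numB q (x a) (x l)) * (\<Prod>b\<in>insert l M - insert l A. den q (x b) (x l)))) +
      pairing q x A (insert l M - A) *
     (W (Suc (card A)) (x l * prod x A) (prod x (insert l M - A)) *
        ((\<Prod>b\<in>insert l M - A. numA q (x b) (x l)) * (\<Prod>a\<in>A. den q (x a) (x l))) +
      W (card A) (prod x A) (x l * prod x (insert l M - A)) *
        ((\<Prod>a\<in>A. numB q (x a) (x l)) * (\<Prod>b\<in>insert l M - A. den q (x b) (x l)))) = 0"
      unfolding i1 i2 using fA fB lA lM
      by (simp add: pairing_insert_left pairing_insert_right d0 a b ab algebra_simps)
  qed
qed

text \<open>At t = q x_l both \<open>den\<close> and \<open>numA\<close> for x_l vanish, so only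
  terms with x_l in A and t on the other side survive. They form, up to a common factor, the sum
  over \<open>L - {l}\<close> whose weight has x_l and q x_l absorbed into its two products; this is
  the sum assumed to be zero.\<close>

lemma cleared_root_q:
  assumes fin: "finite L" and l: "l \<in> L" and gen: "generic_points q x L"
    and IH: "splitsum (\<lambda>k u v. W (Suc k) (x l * u) (q * x l * v)) q x (L - {l}) = 0"
  shows "cleared W q x L (q * x l) = 0"
proof -
  define M where "M = L - {l}"
  have L: "L = insert l M" and lM: "l \<notin> M" and fM: "finite M" using l fin by (auto simp: M_def)
  have d0: "den q (x l) (q * x l) = 0" by (simp add: den_def)
  have n0: "numA q (x l) (q * x l) = 0" by (simp add: numA_def)
  \<comment> \<open>The common factor can be independent of A because, for j outside A,
    \<open>omega q (x l) (x j)\<close> times \<open>den\<close> gives at t = q x_l the same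
    \<open>numB\<close> that occurs for j in A.\<close>
  define c where "c = numB q (x l) (q * x l) * (\<Prod>j\<in>M. numB q (x j) (q * x l))"
  have "cleared W q x L (q * x l) =
      (\<Sum>A\<in>Pow M. c * (W (Suc (card A)) (x l * prod x A) (q * x l * prod x (M - A)) * pairing q x A (M - A)))"
    unfolding cleared_def L sum_Pow_insert[OF fM lM]
  proof (rule sum.cong[OF refl])
    fix A assume A: "A \<in> Pow M"
    hence fA: "finite A" and fB: "finite (M - A)" and lA: "l \<notin> A"
      using fM lM by (auto intro: finite_subset)
    have i1: "insert l M - insert l A = M - A" using lM by auto
    have i2: "insert l M - A = insert l (M - A)" using lA by auto
    have "x l \<noteq> x j" "x j \<noteq> q * x l" if "j \<in> M" for j
      using that gen lM unfolding generic_points_def inj_on_def L by auto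
    hence "omega q (x l) (x j) * den q (x j) (q * x l) = numB q (x j) (q * x l)" if "j \<in> M" for j
      using that unfolding omega_def den_def numB_def by (simp add: divide_simps) (simp add: algebra_simps)
    hence "(\<Prod>j\<in>M - A. omega q (x l) (x j)) * (\<Prod>j\<in>M - A. den q (x j) (q * x l)) = (\<Prod>j\<in>M - A. numB q (x j) (q * x l))"
      by (intro prod_mult_cong) auto
    hence c: "c = numB q (x l) (q * x l) * ((\<Prod>j\<in>M - A. omega q (x l) (x j)) * (\<Prod>j\<in>M - A. den q (x j) (q * x l)) * (\<Prod>j\<in>A. numB q (x j) (q * x l)))"
      unfolding c_def using A fM prod.subset_diff[of A M "\<lambda>j. numB q (x j) (q * x l)"] by simp
    show "pairing q x (insert l A) (insert l M - insert l A) *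
     (W (Suc (card (insert l A))) (q * x l * prod x (insert l A)) (prod x (insert l M - insert l A)) *
        ((\<Prod>b\<in>insert l M - insert l A. numA q (x b) (q * x l)) * (\<Prod>a\<in>insert l A. den q (x a) (q * x l))) +
      W (card (insert l A)) (prod x (insert l A)) (q * x l * prod x (insert l M - insert l A)) *
        ((\<Prod>a\<in>insert l A. numB q (x a) (q * x l)) * (\<Prod>b\<in>insert l M - insert l A. den q (x b) (q * x l)))) +
      pairing q x A (insert l M - A) *
     (W (Suc (card A)) (q * x l * prod x A) (prod x (insert l M - A)) *
        ((\<Prod>b\<in>insert l M - A. numA q (x b) (q * x l)) * (\<Prod>a\<in>A. den q (x a) (q * x l))) +
      W (card A) (prod x A) (q * x l * prod x (insert l M - A)) *
        ((\<Prod>a\<in>A. numB q (x a) (q * x l)) * (\<Prod>b\<in>insert l M - A. den q (x b) (q * x l)))) =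
      c * (W (Suc (card A)) (x l * prod x A) (q * x l * prod x (M - A)) * pairing q x A (M - A))"
      unfolding i1 i2 c using fA fB lA lM
      by (simp add: pairing_insert_left d0 n0 ac_simps)
  qed
  also have "\<dots> = 0" using IH unfolding splitsum_def M_def[symmetric] sum_distrib_left[symmetric] by simp
  finally show ?thesis .
qed

text \<open>The mirror image of the root q x_l: at t = x_l / q both \<open>den\<close> and
  \<open>numB\<close> for x_l vanish, so t lies in A and x_l on the other side, and the common
  factor is a product of values of \<open>numA\<close>.\<close>

lemma cleared_root_inverse_q:
  assumes fin: "finite L" and l: "l \<in> L" and gen: "generic_points q x L"
    and IH: "splitsum (\<lambda>k u v. W (Suc k) (x l / q * u) (x l * v)) q x (L - {l}) = 0"
  shows "cleared W q x L (x l / q) = 0"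
proof -
  define M where "M = L - {l}"
  have L: "L = insert l M" and lM: "l \<notin> M" and fM: "finite M" using l fin by (auto simp: M_def)
  define t where "t = x l / q"
  have q0: "q \<noteq> 0" using gen by (simp add: generic_points_def)
  have xl: "x l = q * t" using q0 by (simp add: t_def)
  have d0: "den q (x l) t = 0" by (simp add: den_def xl)
  have n0: "numB q (x l) t = 0" by (simp add: numB_def xl)
  define c where "c = numA q (x l) t * (\<Prod>j\<in>M. numA q (x j) t)"
  have "cleared W q x L t =
      (\<Sum>A\<in>Pow M. c * (W (Suc (card A)) (t * prod x A) (x l * prod x (M - A)) * pairing q x A (M - A)))"
    unfolding cleared_def L sum_Pow_insert[OF fM lM]
  proof (rule sum.cong[OF refl])
    fix A assume A: "A \<in> Pow M"
    hence fA: "finite A" and fB: "finite (M - A)" and lA: "l \<notin> A"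
      using fM lM by (auto intro: finite_subset)
    have i1: "insert l M - insert l A = M - A" using lM by auto
    have i2: "insert l M - A = insert l (M - A)" using lA by auto
    have "x l \<noteq> x j" "x l \<noteq> q * x j" if "j \<in> M" for j
      using that gen lM unfolding generic_points_def inj_on_def L by auto
    \<comment> \<open>The denominators of \<open>omega\<close> are stated with x_l replaced by q t,
      so that they cancel against the factors of \<open>den\<close> written in t.\<close>
    hence "x j - q * t \<noteq> 0" "q * t - q * x j \<noteq> 0" if "j \<in> M" for j
      using that xl by (metis right_minus_eq)+
    hence "omega q (x j) (q * t) * den q (x j) t = numA q (x j) t" if "j \<in> M" for j
      using that unfolding omega_def den_def numA_def
      by (simp add: nonzero_divide_eq_eq del: right_minus_eq) (simp add: algebra_simps)
    hence "omega q (x j) (x l) * den q (x j) t = numA q (x j) t" if "j \<in> M" for j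
      using that xl by simp
    hence "(\<Prod>j\<in>A. omega q (x j) (x l)) * (\<Prod>j\<in>A. den q (x j) t) = (\<Prod>j\<in>A. numA q (x j) t)"
      using A by (intro prod_mult_cong) auto
    hence c: "c = numA q (x l) t * ((\<Prod>j\<in>A. omega q (x j) (x l)) * (\<Prod>j\<in>A. den q (x j) t) * (\<Prod>j\<in>M - A. numA q (x j) t))"
      unfolding c_def using A fM prod.subset_diff[of A M "\<lambda>j. numA q (x j) t"] by simp
    show "pairing q x (insert l A) (insert l M - insert l A) *
     (W (Suc (card (insert l A))) (t * prod x (insert l A)) (prod x (insert l M - insert l A)) *
        ((\<Prod>b\<in>insert l M - insert l A. numA q (x b) t) * (\<Prod>a\<in>insert l A. den q (x a) t)) +
      W (card (insert l A)) (prod x (insert l A)) (t * prod x (insert l M - insert l A)) *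
        ((\<Prod>a\<in>insert l A. numB q (x a) t) * (\<Prod>b\<in>insert l M - insert l A. den q (x b) t))) +
      pairing q x A (insert l M - A) *
     (W (Suc (card A)) (t * prod x A) (prod x (insert l M - A)) *
        ((\<Prod>b\<in>insert l M - A. numA q (x b) t) * (\<Prod>a\<in>A. den q (x a) t)) +
      W (card A) (prod x A) (t * prod x (insert l M - A)) *
        ((\<Prod>a\<in>A. numB q (x a) t) * (\<Prod>b\<in>insert l M - A. den q (x b) t))) =
      c * (W (Suc (card A)) (t * prod x A) (x l * prod x (M - A)) * pairing q x A (M - A))"
      unfolding i1 i2 c using fA fB lA lM
      by (simp add: pairing_insert_right d0 n0 ac_simps)
  qed
  also have "\<dots> = 0" using IH unfolding splitsum_def M_def[symmetric] t_def[symmetric] sum_distrib_left[symmetric] by simp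
  finally show ?thesis by (simp add: t_def)
qed

text \<open>As a function of the variable of index \<open>m\<close>, the cleared sum divided by t is
  off zero a polynomial of degree below 3|L|, and it vanishes at the 3|L| distinct points x_l, q
  x_l, x_l / q. Hence it vanishes at x_m, where the cleared denominators are nonzero.\<close>

lemma splitsum_insert_eq_0:
  fixes x :: "'i \<Rightarrow> 'a::field"
  assumes fin: "finite L" and m: "m \<notin> L" and gen: "generic_points q x (insert m L)"
    and c1: "\<And>A. A \<subseteq> L \<Longrightarrow> poly_off_zero (2 * card (L - A))
              (\<lambda>t. W (Suc (card A)) (t * prod x A) (prod x (L - A)) * t ^ card (L - A) / t)"
    and c2: "\<And>A. A \<subseteq> L \<Longrightarrow> poly_off_zero (2 * card A)
              (\<lambda>t. W (card A) (prod x A) (t * prod x (L - A)) * t ^ card A / t)"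
    and r1: "\<And>l. l \<in> L \<Longrightarrow> splitsum (\<lambda>k u v. W (Suc k) (x l * u) (q * x l * v)) q x (L - {l}) = 0"
    and r2: "\<And>l. l \<in> L \<Longrightarrow> splitsum (\<lambda>k u v. W (Suc k) (x l / q * u) (x l * v)) q x (L - {l}) = 0"
  shows "splitsum W q x (insert m L) = 0"
proof -
  have genL: "generic_points q x L" using gen by (rule generic_points_subset) auto
  have q0: "q \<noteq> 0" and inj: "inj_on x L" and nz: "0 \<notin> x ` L"
    and ne: "\<And>i j. i \<in> L \<Longrightarrow> j \<in> L \<Longrightarrow> x i \<noteq> q * x j \<and> x i \<noteq> q^2 * x j"
    using genL unfolding generic_points_def by auto
  define R1 where "R1 = x ` L"
  define R2 where "R2 = (\<lambda>l. q * x l) ` L"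
  define R3 where "R3 = (\<lambda>l. x l / q) ` L"
  have cards: "card R1 = card L" "card R2 = card L" "card R3 = card L"
    unfolding R1_def R2_def R3_def using inj q0
    by (auto intro!: card_image simp: inj_on_def)
  have fins: "finite R1" "finite R2" "finite R3" unfolding R1_def R2_def R3_def using fin by auto
  \<comment> \<open>Disjointness of \<open>R3\<close> from \<open>R1\<close> amounts to x_j
    differing from q x_i, and disjointness from \<open>R2\<close> to x_j differing from q^2
    x_i.\<close>
  have "x j / q \<noteq> x i \<and> x j / q \<noteq> q * x i" if "i \<in> L" "j \<in> L" for i j
    using ne[OF that(2,1)] q0 by (auto simp: field_simps power2_eq_square)
  hence dis: "R1 \<inter> R2 = {}" "(R1 \<union> R2) \<inter> R3 = {}"
    unfolding R1_def R2_def R3_def using ne by auto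
  have cardR: "card (R1 \<union> R2 \<union> R3) = 3 * card L"
    using fins dis cards by (simp add: card_Un_disjoint)
  have zR: "0 \<notin> R1 \<union> R2 \<union> R3" unfolding R1_def R2_def R3_def using nz q0 by auto
  have z: "cleared W q x L t / t = 0" if "t \<in> R1 \<union> R2 \<union> R3" for t
    using that cleared_root_equal[OF fin _ genL, of _ W] cleared_root_q[OF fin _ genL r1]
      cleared_root_inverse_q[OF fin _ genL r2] unfolding R1_def R2_def R3_def by auto
  have xm: "x m \<noteq> 0" using gen by (auto simp: generic_points_def)
  have "poly_off_zero (3 * card L) (\<lambda>t. cleared W q x L t / t)"
    by (rule poly_off_zero_cleared[OF fin c1 c2])
  hence "cleared W q x L (x m) / x m = 0"
    by (rule poly_off_zero_eq_0[where R = "R1 \<union> R2 \<union> R3"]) (use fins zR cardR xm z in simp_all)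
  hence "splitsum W q x (insert m L) * (\<Prod>l\<in>L. den q (x l) (x m)) = 0"
    using splitsum_insert_cleared[OF fin m gen, of W] xm by simp
  moreover have "x m \<noteq> x l" "x l \<noteq> q * x m" "x m \<noteq> q * x l" if "l \<in> L" for l
    using that gen m unfolding generic_points_def inj_on_def by auto
  hence "(\<Prod>l\<in>L. den q (x l) (x m)) \<noteq> 0" using fin by (auto simp: den_def)
  ultimately show ?thesis by simp
qed

lemma poly_off_zero_if: "(P \<Longrightarrow> poly_off_zero n f) \<Longrightarrow> poly_off_zero n (\<lambda>t. if P then f t else 0)"
  by (cases P) auto

lemma splitsum_scale:
  assumes "\<And>k u v. W' k u v = c * W k u v"
  shows "splitsum W' q x L = c * splitsum W q x L"
  unfolding splitsum_def assms sum_distrib_left by (simp add: mult.assoc)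

lemma card_Diff_eq: "finite L \<Longrightarrow> A \<subseteq> L \<Longrightarrow> card L = card A + card (L - A)"
  by (simp add: card_Diff_subset card_mono finite_subset)

section \<open>The two identities for generic parameter\<close>

text \<open>With x_L^n taken out, the product with exponents n, n + 1 leaves the product v over L -
  A for |A| = a, and the product in reverse order leaves u over A for |A| = b. Two separate
  conditionals are added because a = b is possible.\<close>

definition comm_weight :: "'a::field \<Rightarrow> nat \<Rightarrow> nat \<Rightarrow> nat \<Rightarrow> 'a \<Rightarrow> 'a \<Rightarrow> 'a" where
  "comm_weight q a b k u v = (if k = a then v else 0) + (if k = b then - (q ^ min a b * u) else 0)"

text \<open>With x_L^n taken out, the 1 comes from the square of M_{\<alpha>,n}, the term q^a u / v
  from exponents n + 1 and n - 1, and the -1 from the product of M_{\<alpha>+1,n} and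
  M_{\<alpha>-1,n}, where A has one element more than half of L.\<close>

definition quad_weight :: "'a::field \<Rightarrow> nat \<Rightarrow> nat \<Rightarrow> 'a \<Rightarrow> 'a \<Rightarrow> 'a" where
  "quad_weight q a k u v = (if k = a then 1 - q ^ a * (u / v) else 0) + (if k = Suc a then - 1 else 0)"

lemma sum_Pow_card_0:
  assumes "finite L"
  shows "(\<Sum>A\<in>Pow L. if card A = 0 then f A else 0) = f {}"
proof -
  have "(\<Sum>A\<in>Pow L. if card A = 0 then f A else 0) = (\<Sum>A\<in>Pow L. if A = {} then f A else 0)"
    using assms by (intro sum.cong refl) (auto dest: finite_subset)
  thus ?thesis using assms by (simp add: sum.delta)
qed

lemma sum_Pow_card_full:
  assumes "finite L"
  shows "(\<Sum>A\<in>Pow L. if card A = card L then f A else 0) = f L"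
proof -
  have "(\<Sum>A\<in>Pow L. if card A = card L then f A else 0) = (\<Sum>A\<in>Pow L. if A = L then f A else 0)"
    using assms by (intro sum.cong refl) (auto dest: card_subset_eq)
  thus ?thesis using assms by (simp add: sum.delta)
qed

lemma pairing_empty [simp]: "pairing q x {} B = 1" "pairing q x A {} = 1"
  by (simp_all add: pairing_def)

lemma splitsum_comm_weight_eq:
  "splitsum (comm_weight q a b) q x L =
     (\<Sum>A\<in>Pow L. if card A = a then prod x (L - A) * pairing q x A (L - A) else 0) -
     q ^ min a b * (\<Sum>A\<in>Pow L. if card A = b then prod x A * pairing q x A (L - A) else 0)"
  unfolding splitsum_def comm_weight_def sum_distrib_left sum_subtractf[symmetric]
  by (intro sum.cong refl) (auto simp: algebra_simps)

text \<open>Each step removes two variables and lowers both a and b by one. If a or b is 0, each of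
  the two sums has a single term and both equal the product over L.\<close>

lemma splitsum_comm_weight_generic:
  fixes x :: "'i \<Rightarrow> 'a::field"
  assumes "finite L" "card L = a + b" "generic_points q x L"
  shows "splitsum (comm_weight q a b) q x L = 0"
  using assms
proof (induction a arbitrary: b L)
  case 0
  thus ?case unfolding splitsum_comm_weight_eq
    using sum_Pow_card_0[of L "\<lambda>A. prod x (L - A) * pairing q x A (L - A)"]
      sum_Pow_card_full[of L "\<lambda>A. prod x A * pairing q x A (L - A)"] by simp
next
  case (Suc a)
  show ?case
  proof (cases b)
    case 0
    thus ?thesis unfolding splitsum_comm_weight_eq using Suc.prems
      sum_Pow_card_0[of L "\<lambda>A. prod x A * pairing q x A (L - A)"]
      sum_Pow_card_full[of L "\<lambda>A. prod x (L - A) * pairing q x A (L - A)"] by simp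
  next
    case b: (Suc b')
    have "L \<noteq> {}" using Suc.prems by auto
    then obtain m M where L: "L = insert m M" "m \<notin> M" by (meson ex_in_conv mk_disjoint_insert)
    have fM: "finite M" using Suc.prems(1) L by simp
    have cM: "card M = Suc (a + b')" using Suc.prems L b fM by simp
    have q0: "q \<noteq> 0" using Suc.prems(3) by (simp add: generic_points_def)
    show ?thesis unfolding L(1)
    proof (rule splitsum_insert_eq_0[OF fM L(2)])
      show "generic_points q x (insert m M)" using Suc.prems(3) L by simp
    next
      fix A assume "A \<subseteq> M"
      hence c: "card A + card (M - A) = Suc (a + b')" using card_Diff_eq[OF fM] cM by simp
      \<comment> \<open>The exponents are those left after division by t. The first term keeps |M -
        A| - 1 = b'; the second has an extra t from its weight and keeps |M - A| = a + 1.\<close>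
      have "poly_off_zero (2 * card (M - A)) (\<lambda>t. if card A = a then prod x (M - A) * t ^ b' else 0)"
        by (intro poly_off_zero_if poly_off_zero_monom) (use c in simp)
      moreover have "poly_off_zero (2 * card (M - A))
          (\<lambda>t. if card A = b' then - (q ^ min (Suc a) b) * prod x A * t ^ Suc a else 0)"
        by (intro poly_off_zero_if poly_off_zero_monom) (use c in simp)
      ultimately have "poly_off_zero (2 * card (M - A))
          (\<lambda>t. (if card A = a then prod x (M - A) * t ^ b' else 0) +
             (if card A = b' then - (q ^ min (Suc a) b) * prod x A * t ^ Suc a else 0))"
        by (rule poly_off_zero_add)
      thus "poly_off_zero (2 * card (M - A))
              (\<lambda>t. comm_weight q (Suc a) b (Suc (card A)) (t * prod x A) (prod x (M - A)) * t ^ card (M - A) / t)"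
      proof (rule poly_off_zero_cong)
        fix t :: 'a assume t: "t \<noteq> 0"
        have "card A = a \<Longrightarrow> card (M - A) = Suc b'" "card A = b' \<Longrightarrow> card (M - A) = Suc a"
          using c by auto
        thus "comm_weight q (Suc a) b (Suc (card A)) (t * prod x A) (prod x (M - A)) * t ^ card (M - A) / t =
          (if card A = a then prod x (M - A) * t ^ b' else 0) +
             (if card A = b' then - (q ^ min (Suc a) b) * prod x A * t ^ Suc a else 0)"
          using t unfolding comm_weight_def b
          by (cases "card A = a"; cases "card A = b'") (simp_all add: field_simps)
      qed
      have "poly_off_zero (2 * card A) (\<lambda>t. if card A = Suc a then prod x (M - A) * t ^ Suc a else 0)"
        by (intro poly_off_zero_if poly_off_zero_monom) simp
      moreover have "poly_off_zero (2 * card A)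
          (\<lambda>t. if card A = b then - (q ^ min (Suc a) b) * prod x A * t ^ b' else 0)"
        by (intro poly_off_zero_if poly_off_zero_monom) (use b in simp)
      ultimately have "poly_off_zero (2 * card A)
          (\<lambda>t. (if card A = Suc a then prod x (M - A) * t ^ Suc a else 0) +
             (if card A = b then - (q ^ min (Suc a) b) * prod x A * t ^ b' else 0))"
        by (rule poly_off_zero_add)
      thus "poly_off_zero (2 * card A)
              (\<lambda>t. comm_weight q (Suc a) b (card A) (prod x A) (t * prod x (M - A)) * t ^ card A / t)"
      proof (rule poly_off_zero_cong)
        fix t :: 'a assume t: "t \<noteq> 0"
        thus "comm_weight q (Suc a) b (card A) (prod x A) (t * prod x (M - A)) * t ^ card A / t =
          (if card A = Suc a then prod x (M - A) * t ^ Suc a else 0) +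
             (if card A = b then - (q ^ min (Suc a) b) * prod x A * t ^ b' else 0)"
          unfolding comm_weight_def b
          by (cases "card A = Suc a"; cases "card A = Suc b'") (simp_all add: field_simps)
      qed
    next
      fix l assume l: "l \<in> M"
      have IH: "splitsum (comm_weight q a b') q x (M - {l}) = 0"
      proof (rule Suc.IH)
        show "finite (M - {l})" using fM by simp
        show "card (M - {l}) = a + b'" using fM cM l by simp
        show "generic_points q x (M - {l})" using Suc.prems(3) L by (auto intro: generic_points_subset)
      qed
      \<comment> \<open>Lowering a and b lowers their minimum by one, so one factor q is released:
        here it matches the q in q x_l, and in the second case below it cancels the division by
        q.\<close>
      have "splitsum (\<lambda>k u v. comm_weight q (Suc a) b (Suc k) (x l * u) (q * x l * v)) q x (M - {l}) =
         q * x l * splitsum (comm_weight q a b') q x (M - {l})"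
        by (rule splitsum_scale) (simp add: comm_weight_def b algebra_simps)
      thus "splitsum (\<lambda>k u v. comm_weight q (Suc a) b (Suc k) (x l * u) (q * x l * v)) q x (M - {l}) = 0"
        using IH by simp
      have "splitsum (\<lambda>k u v. comm_weight q (Suc a) b (Suc k) (x l / q * u) (x l * v)) q x (M - {l}) =
         x l * splitsum (comm_weight q a b') q x (M - {l})"
        by (rule splitsum_scale) (simp add: comm_weight_def b q0 algebra_simps)
      thus "splitsum (\<lambda>k u v. comm_weight q (Suc a) b (Suc k) (x l / q * u) (x l * v)) q x (M - {l}) = 0"
        using IH by simp
    qed
  qed
qed

text \<open>Removing a pair of variables lowers a by one and leaves the weight unchanged, since the
  ratio u / v is divided by q while q^a gains a factor q. The degree argument starts only at four
  variables.\<close>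

lemma splitsum_quad_weight_generic:
  fixes x :: "'i \<Rightarrow> 'a::field"
  assumes "finite L" "card L = 2 * a" "generic_points q x L"
  shows "splitsum (quad_weight q a) q x L = 0"
  using assms
proof (induction a arbitrary: L)
  case 0
  thus ?case by (simp add: splitsum_def quad_weight_def)
next
  case (Suc a)
  have q0: "q \<noteq> 0" using Suc.prems(3) by (simp add: generic_points_def)
  show ?case
  proof (cases a)
    case 0
    \<comment> \<open>Two variables are treated directly: with a single remaining variable, dividing
      by t leaves a term 1 / t, so the polynomial condition fails. The identity reduces to x_l /
      (x_l - x_m) + x_m / (x_m - x_l) = 1.\<close>
    then obtain l m where L: "L = {l, m}" "l \<noteq> m" using Suc.prems(2) by (auto simp: card_2_iff)
    have ne: "x l \<noteq> 0" "x m \<noteq> 0" "x l - x m \<noteq> 0" "x m - x l \<noteq> 0" "x m - q * x l \<noteq> 0" "x l - q * x m \<noteq> 0"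
      using Suc.prems(3) L unfolding generic_points_def inj_on_def by auto
    have d: "{l, m} - {m} = {l}" "{l, m} - {l} = {m}" using L(2) by auto
    \<comment> \<open>The weight 1 - q u / v cancels exactly the pole v - q u of
      \<open>omega\<close>.\<close>
    have *: "(1 - q * (u / v)) * (u * v / ((u - v) * (v - q * u))) = u / (u - v)"
      if "v \<noteq> 0" "u - v \<noteq> 0" "v - q * u \<noteq> 0" for u v
    proof -
      have "1 - q * (u / v) = (v - q * u) / v" using that(1) by (simp add: field_simps)
      thus ?thesis using that by simp
    qed
    have "splitsum (quad_weight q (Suc 0)) q x {l, m} =
       (1 - q * (x l / x m)) * omega q (x l) (x m) + (1 - q * (x m / x l)) * omega q (x m) (x l) - 1"
      unfolding splitsum_def using L(2)
      by (simp add: sum_Pow_insert Pow_insert quad_weight_def pairing_def d)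
    also have "\<dots> = x l / (x l - x m) + x m / (x m - x l) - 1"
      unfolding omega_def using ne by (simp only: * not_False_eq_True)
    also have "\<dots> = 0"
    proof -
      have "x m / (x m - x l) = - (x m / (x l - x m))" by (metis minus_diff_eq minus_divide_right)
      thus ?thesis using ne by (simp add: diff_divide_distrib[symmetric])
    qed
    finally show ?thesis using L 0 by simp
  next
    case a: (Suc b)
    have "L \<noteq> {}" using Suc.prems by auto
    then obtain m M where L: "L = insert m M" "m \<notin> M" by (meson ex_in_conv mk_disjoint_insert)
    have fM: "finite M" using Suc.prems(1) L by simp
    have cM: "card M = 2 * a + 1" using Suc.prems L fM by simp
    show ?thesis unfolding L(1)
    proof (rule splitsum_insert_eq_0[OF fM L(2)])
      show "generic_points q x (insert m M)" using Suc.prems(3) L by simp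
    next
      fix A assume "A \<subseteq> M"
      hence c: "card A + card (M - A) = 2 * a + 1" using card_Diff_eq[OF fM] cM by simp
      \<comment> \<open>The part of the ratio term that is constant in t: the term is r t with t on
        the side of A and r / t on the other, where a = b + 1 leaves enough powers of t.\<close>
      define r where "r = q ^ Suc a * (prod x A / prod x (M - A))"
      have "poly_off_zero (2 * card (M - A)) (\<lambda>t. if card A = a then 1 * t ^ a + (- r) * t ^ Suc a else 0)"
        by (intro poly_off_zero_if poly_off_zero_add poly_off_zero_monom) (use c in simp_all)
      moreover have "poly_off_zero (2 * card (M - A)) (\<lambda>t. if card A = Suc a then (- 1) * t ^ b else 0)"
        by (intro poly_off_zero_if poly_off_zero_monom) (use c a in simp)
      ultimately have "poly_off_zero (2 * card (M - A))
          (\<lambda>t. (if card A = a then 1 * t ^ a + (- r) * t ^ Suc a else 0) +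
               (if card A = Suc a then (- 1) * t ^ b else 0))"
        by (rule poly_off_zero_add)
      thus "poly_off_zero (2 * card (M - A))
              (\<lambda>t. quad_weight q (Suc a) (Suc (card A)) (t * prod x A) (prod x (M - A)) * t ^ card (M - A) / t)"
      proof (rule poly_off_zero_cong)
        fix t :: 'a assume t: "t \<noteq> 0"
        have "card A = a \<Longrightarrow> card (M - A) = Suc a" "card A = Suc a \<Longrightarrow> card (M - A) = Suc b"
          using c a by auto
        moreover have "q ^ Suc a * (t * prod x A / prod x (M - A)) = r * t" by (simp add: r_def)
        ultimately show "quad_weight q (Suc a) (Suc (card A)) (t * prod x A) (prod x (M - A)) * t ^ card (M - A) / t =
          (if card A = a then 1 * t ^ a + (- r) * t ^ Suc a else 0) +
               (if card A = Suc a then (- 1) * t ^ b else 0)"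
          using t unfolding quad_weight_def
          by (cases "card A = a"; cases "card A = Suc a") (simp_all add: left_diff_distrib diff_divide_distrib)
      qed
      have "poly_off_zero (2 * card A) (\<lambda>t. if card A = Suc a then 1 * t ^ a + (- r) * t ^ b else 0)"
        by (intro poly_off_zero_if poly_off_zero_add poly_off_zero_monom) (use a in simp_all)
      moreover have "poly_off_zero (2 * card A) (\<lambda>t. if card A = Suc (Suc a) then (- 1) * t ^ Suc a else 0)"
        by (intro poly_off_zero_if poly_off_zero_monom) simp
      ultimately have "poly_off_zero (2 * card A)
          (\<lambda>t. (if card A = Suc a then 1 * t ^ a + (- r) * t ^ b else 0) +
             (if card A = Suc (Suc a) then (- 1) * t ^ Suc a else 0))"
        by (rule poly_off_zero_add)
      thus "poly_off_zero (2 * card A)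
              (\<lambda>t. quad_weight q (Suc a) (card A) (prod x A) (t * prod x (M - A)) * t ^ card A / t)"
      proof (rule poly_off_zero_cong)
        fix t :: 'a assume t: "t \<noteq> 0"
        have "q ^ Suc a * (prod x A / (t * prod x (M - A))) = r / t" by (simp add: r_def)
        thus "quad_weight q (Suc a) (card A) (prod x A) (t * prod x (M - A)) * t ^ card A / t =
          (if card A = Suc a then 1 * t ^ a + (- r) * t ^ b else 0) +
             (if card A = Suc (Suc a) then (- 1) * t ^ Suc a else 0)"
          using t a unfolding quad_weight_def
          by (cases "card A = Suc a"; cases "card A = Suc (Suc a)") (simp_all add: left_diff_distrib diff_divide_distrib)
      qed
    next
      fix l assume l: "l \<in> M"
      have xl: "x l \<noteq> 0" using Suc.prems(3) l L by (auto simp: generic_points_def)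
      have IH: "splitsum (quad_weight q a) q x (M - {l}) = 0"
      proof (rule Suc.IH)
        show "finite (M - {l})" using fM by simp
        show "card (M - {l}) = 2 * a" using fM cM l by simp
        show "generic_points q x (M - {l})" using Suc.prems(3) L by (auto intro: generic_points_subset)
      qed
      have "splitsum (\<lambda>k u v. quad_weight q (Suc a) (Suc k) (x l * u) (q * x l * v)) q x (M - {l}) =
         1 * splitsum (quad_weight q a) q x (M - {l})"
        by (rule splitsum_scale) (simp add: quad_weight_def xl q0)
      thus "splitsum (\<lambda>k u v. quad_weight q (Suc a) (Suc k) (x l * u) (q * x l * v)) q x (M - {l}) = 0"
        using IH by simp
      have "splitsum (\<lambda>k u v. quad_weight q (Suc a) (Suc k) (x l / q * u) (x l * v)) q x (M - {l}) =
         1 * splitsum (quad_weight q a) q x (M - {l})"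
        by (rule splitsum_scale) (simp add: quad_weight_def xl q0)
      thus "splitsum (\<lambda>k u v. quad_weight q (Suc a) (Suc k) (x l / q * u) (x l * v)) q x (M - {l}) = 0"
        using IH by simp
    qed
  qed
qed

section \<open>Specialising the parameter\<close>

definition off_diagonal :: "'i set \<Rightarrow> ('i \<times> 'i) set" where
  "off_diagonal L = {(i, j). i \<in> L \<and> j \<in> L \<and> i \<noteq> j}"

lemma finite_off_diagonal: "finite L \<Longrightarrow> finite (off_diagonal L)"
  by (rule finite_subset[of _ "L \<times> L"]) (auto simp: off_diagonal_def)

text \<open>The parameter enters a pairing only through the denominators x_j - q x_i. Multiplying by
  these over all ordered pairs makes every pairing polynomial in q, with one common factor for all
  A.\<close>

lemma pairing_clear_denominators:
  assumes fin: "finite L" and A: "A \<subseteq> L"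
    and ne: "\<And>i j. i \<in> L \<Longrightarrow> j \<in> L \<Longrightarrow> i \<noteq> j \<Longrightarrow> x j - q * x i \<noteq> 0"
  shows "pairing q x A (L - A) * (\<Prod>(i, j)\<in>off_diagonal L. x j - q * x i) =
    (\<Prod>(i, j)\<in>off_diagonal L. if i \<in> A \<and> j \<notin> A then x i * x j / (x i - x j) else x j - q * x i)"
proof -
  have "pairing q x A (L - A) = (\<Prod>p\<in>A \<times> (L - A). omega q (x (fst p)) (x (snd p)))"
    unfolding pairing_def by (simp add: prod.cartesian_product split_def)
  also have "\<dots> = (\<Prod>p\<in>off_diagonal L. if p \<in> A \<times> (L - A) then omega q (x (fst p)) (x (snd p)) else 1)"
    unfolding prod.inter_restrict[OF finite_off_diagonal[OF fin], symmetric]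
    using A by (intro prod.cong) (auto simp: off_diagonal_def)
  finally show ?thesis
  proof (simp only: prod.distrib[symmetric], intro prod.cong refl)
    fix p assume "p \<in> off_diagonal L"
    then obtain i j where "p = (i, j)" "i \<in> L" "j \<in> L" "i \<noteq> j" by (auto simp: off_diagonal_def)
    thus "(if p \<in> A \<times> (L - A) then omega q (x (fst p)) (x (snd p)) else 1) *
        (case p of (i, j) \<Rightarrow> x j - q * x i) =
      (case p of (i, j) \<Rightarrow> if i \<in> A \<and> j \<notin> A then x i * x j / (x i - x j) else x j - q * x i)"
      using ne[of i j] by (simp add: omega_def)
  qed
qed

section \<open>Passage to the fraction field of polynomials in the parameter\<close>

lemma to_fract_prod: "to_fract (\<Prod>i\<in>S. f i) = (\<Prod>i\<in>S. to_fract (f i))"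
  by (induction S rule: infinite_finite_induct) auto

lemma to_fract_power: "to_fract (p ^ n) = to_fract p ^ n"
  by (induction n) auto

lemma to_fract_sum: "to_fract (\<Sum>i\<in>S. f i) = (\<Sum>i\<in>S. to_fract (f i))"
  by (induction S rule: infinite_finite_induct) auto

lemma to_fract_const_divide: "to_fract [:a / b:] = to_fract [:a:] / to_fract [:b:]" for a b :: "'a::field"
proof (cases "b = 0")
  case False
  have "to_fract [:a / b:] * to_fract [:b:] = to_fract [:a:]"
    using False by (simp flip: to_fract_mult)
  thus ?thesis using False by (simp add: eq_divide_eq)
qed simp

text \<open>The indeterminate or its square times a nonzero constant is never a constant, so
  distinct nonzero constants are generic for it.\<close>

lemma generic_points_indeterminate:
  fixes x :: "'i \<Rightarrow> 'a::field"
  assumes "inj_on x L" "0 \<notin> x ` L"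
  shows "generic_points (to_fract [:0, 1:]) (\<lambda>i. to_fract [:x i:]) L"
proof -
  have "to_fract [:a:] \<noteq> to_fract [:0, 1:] * to_fract [:b:]"
    "to_fract [:a:] \<noteq> to_fract [:0, 1:]^2 * to_fract [:b:]" if "b \<noteq> 0" for a b :: 'a
    using that by (auto simp: power2_eq_square simp flip: to_fract_mult)
  thus ?thesis using assms unfolding generic_points_def inj_on_def
    by (auto simp: image_iff)
qed

text \<open>Multiplying by \<open>D\<close> turns the identity over the fraction field into one
  between polynomials, which may be evaluated at q; dividing by the value of \<open>D\<close> gives
  the claim. \<open>D\<close> has only factors with i \<noteq> j, so its value is nonzero even where
  q = 1 or x_j = q^2 x_i.\<close>

lemma specialise_indeterminate:
  fixes x :: "'i \<Rightarrow> 'a::field" and w :: "'i set \<Rightarrow> 'a poly"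
  assumes fin: "finite L" and inj: "inj_on x L" and nz: "0 \<notin> x ` L"
    and ne: "\<And>i j. i \<in> L \<Longrightarrow> j \<in> L \<Longrightarrow> i \<noteq> j \<Longrightarrow> x j \<noteq> q * x i"
    and zero: "(\<Sum>A\<in>Pow L. to_fract (w A) *
      pairing (to_fract [:0, 1:]) (\<lambda>i. to_fract [:x i:]) A (L - A)) = 0"
  shows "(\<Sum>A\<in>Pow L. poly (w A) q * pairing q x A (L - A)) = 0"
proof -
  define D where "D = (\<Prod>(i, j)\<in>off_diagonal L. [:x j, - x i:])"
  define C where "C = (\<lambda>A. \<Prod>(i, j)\<in>off_diagonal L.
    if i \<in> A \<and> j \<notin> A then [:x i * x j / (x i - x j):] else [:x j, - x i:])"
  have lin: "to_fract [:b, - a:] = to_fract [:b:] - to_fract [:0, 1:] * to_fract [:a:]" for a b :: 'a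
    by (simp flip: to_fract_mult to_fract_diff)
  have quot: "to_fract [:a * b / (a - b):] = to_fract [:a:] * to_fract [:b:] / (to_fract [:a:] - to_fract [:b:])" for a b :: 'a
    by (simp add: to_fract_const_divide flip: to_fract_mult to_fract_diff)
  \<comment> \<open>The same polynomials \<open>C A\<close> and \<open>D\<close> describe the
    pairing for the indeterminate and, in \<open>C2\<close>, the pairing at the value q.\<close>
  have C1: "pairing (to_fract [:0, 1:]) (\<lambda>i. to_fract [:x i:]) A (L - A) * to_fract D = to_fract (C A)"
    if "A \<in> Pow L" for A
  proof -
    have "to_fract [:x j:] - to_fract [:0, 1:] * to_fract [:x i:] \<noteq> 0" if "i \<in> L" for i j
      unfolding lin[symmetric] using nz that by auto
    thus ?thesis
      using pairing_clear_denominators[OF fin, of A "\<lambda>i. to_fract [:x i:]" "to_fract [:0, 1:]"] that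
      unfolding D_def C_def to_fract_prod split_def if_distrib[of to_fract] lin quot by simp
  qed
  have C2: "pairing q x A (L - A) * poly D q = poly (C A) q" if "A \<in> Pow L" for A
    using pairing_clear_denominators[OF fin, of A x q] that ne
    unfolding D_def C_def poly_prod split_def by (simp add: if_distrib[of "\<lambda>p. poly p q"] cong: if_cong)
  have "to_fract (\<Sum>A\<in>Pow L. w A * C A) = (\<Sum>A\<in>Pow L. to_fract (w A) *
      pairing (to_fract [:0, 1:]) (\<lambda>i. to_fract [:x i:]) A (L - A)) * to_fract D"
    unfolding to_fract_sum sum_distrib_right by (intro sum.cong refl) (simp add: C1[symmetric])
  hence "(\<Sum>A\<in>Pow L. w A * C A) = 0" by (simp only: zero mult_zero_left to_fract_eq_0_iff)
  hence "poly (\<Sum>A\<in>Pow L. w A * C A) q = 0" by simp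
  hence "(\<Sum>A\<in>Pow L. poly (w A) q * pairing q x A (L - A)) * poly D q = 0"
    unfolding poly_sum sum_distrib_right poly_mult by (simp add: C2[symmetric] mult.assoc)
  moreover have "poly D q \<noteq> 0"
    unfolding D_def poly_prod using finite_off_diagonal[OF fin] ne by (auto simp: off_diagonal_def)
  ultimately show ?thesis by simp
qed

lemma to_fract_prod_const: "(\<Prod>i\<in>S. to_fract [:x i:]) = to_fract [:prod x S:]" for x :: "'i \<Rightarrow> 'a::field"
  by (induction S rule: infinite_finite_induct) (auto simp flip: to_fract_mult simp: one_pCons[symmetric])

lemma splitsum_comm_weight:
  fixes x :: "'i \<Rightarrow> 'a::field"
  assumes fin: "finite L" and card: "card L = a + b" and inj: "inj_on x L" and nz: "0 \<notin> x ` L"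
    and ne: "\<And>i j. i \<in> L \<Longrightarrow> j \<in> L \<Longrightarrow> i \<noteq> j \<Longrightarrow> x j \<noteq> q * x i"
  shows "splitsum (comm_weight q a b) q x L = 0"
proof -
  \<comment> \<open>The weight as a polynomial in the parameter: its image in the fraction field is
    the generic weight, its value at q the required one.\<close>
  define w where "w = (\<lambda>A. (if card A = a then [:prod x (L - A):] else 0) +
    (if card A = b then - ([:0, 1:] ^ min a b * [:prod x A:]) else 0))"
  have w1: "comm_weight (to_fract [:0, 1:]) a b (card A) (\<Prod>i\<in>A. to_fract [:x i:]) (\<Prod>i\<in>L - A. to_fract [:x i:]) = to_fract (w A)" for A
    unfolding comm_weight_def w_def to_fract_prod_const
    by (simp add: to_fract_power if_distrib[of to_fract] del: mult_pCons_left mult_pCons_right)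
  have w2: "comm_weight q a b (card A) (prod x A) (prod x (L - A)) = poly (w A) q" for A
    unfolding comm_weight_def w_def by simp
  show ?thesis unfolding splitsum_def w2
    using splitsum_comm_weight_generic[OF fin card generic_points_indeterminate[OF inj nz]]
    unfolding splitsum_def w1 by (intro specialise_indeterminate[OF fin inj nz ne])
qed

lemma splitsum_quad_weight:
  fixes x :: "'i \<Rightarrow> 'a::field"
  assumes fin: "finite L" and card: "card L = 2 * a" and inj: "inj_on x L" and nz: "0 \<notin> x ` L"
    and ne: "\<And>i j. i \<in> L \<Longrightarrow> j \<in> L \<Longrightarrow> i \<noteq> j \<Longrightarrow> x j \<noteq> q * x i"
  shows "splitsum (quad_weight q a) q x L = 0"
proof -
  define w where "w = (\<lambda>A. (if card A = a then 1 - [:0, 1:] ^ a * [:prod x A / prod x (L - A):] else 0) +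
    (if card A = Suc a then - 1 else 0))"
  have w1: "quad_weight (to_fract [:0, 1:]) a (card A) (\<Prod>i\<in>A. to_fract [:x i:]) (\<Prod>i\<in>L - A. to_fract [:x i:]) = to_fract (w A)" for A
    unfolding quad_weight_def w_def to_fract_prod_const
    by (simp add: to_fract_power to_fract_const_divide if_distrib[of to_fract] del: mult_pCons_left mult_pCons_right)
  have w2: "quad_weight q a (card A) (prod x A) (prod x (L - A)) = poly (w A) q" for A
    unfolding quad_weight_def w_def by simp
  show ?thesis unfolding splitsum_def w2
    using splitsum_quad_weight_generic[OF fin card generic_points_indeterminate[OF inj nz]]
    unfolding splitsum_def w1 by (intro specialise_indeterminate[OF fin inj nz ne])
qed

section \<open>Composition of the operators\<close>

definition ratio_prod :: "('i \<Rightarrow> 'a::field) \<Rightarrow> 'i set \<Rightarrow> 'i set \<Rightarrow> 'a" where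
  "ratio_prod x S T = (\<Prod>i\<in>S. \<Prod>j\<in>T. x i / (x i - x j))"

lemma ratio_prod_Un_left:
  "finite S \<Longrightarrow> finite S' \<Longrightarrow> S \<inter> S' = {} \<Longrightarrow>
    ratio_prod x (S \<union> S') T = ratio_prod x S T * ratio_prod x S' T"
  unfolding ratio_prod_def by (rule prod.union_disjoint)

lemma ratio_prod_Un_right:
  "finite T \<Longrightarrow> finite T' \<Longrightarrow> T \<inter> T' = {} \<Longrightarrow>
    ratio_prod x S (T \<union> T') = ratio_prod x S T * ratio_prod x S T'"
  unfolding ratio_prod_def prod.distrib[symmetric] by (intro prod.cong refl prod.union_disjoint)

text \<open>The ratios are homogeneous of degree 0, so scaling both variables by q cancels.\<close>

lemma ratio_prod_qshift_inside:
  assumes "q \<noteq> 0" "S \<subseteq> I" "T \<subseteq> I"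
  shows "ratio_prod (qshift q I x) S T = ratio_prod x S T"
  unfolding ratio_prod_def
proof (intro prod.cong refl)
  fix i j assume "i \<in> S" "j \<in> T"
  hence "i \<in> I" "j \<in> I" using assms by auto
  thus "qshift q I x i / (qshift q I x i - qshift q I x j) = x i / (x i - x j)"
    using assms(1) by (simp add: qshift_def flip: right_diff_distrib)
qed

lemma ratio_prod_cong:
  "(\<And>i. i \<in> S \<Longrightarrow> x i = y i) \<Longrightarrow> (\<And>i. i \<in> T \<Longrightarrow> x i = y i) \<Longrightarrow> ratio_prod x S T = ratio_prod y S T"
  unfolding ratio_prod_def by (intro prod.cong refl) simp

lemma ratio_prod_pairing:
  assumes "A \<subseteq> I" "B \<inter> I = {}"
  shows "ratio_prod x A B * ratio_prod (qshift q I x) B A = pairing q x A B"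
proof -
  have "ratio_prod (qshift q I x) B A = (\<Prod>i\<in>A. \<Prod>j\<in>B. qshift q I x j / (qshift q I x j - qshift q I x i))"
    unfolding ratio_prod_def by (rule prod.swap)
  also have "\<dots> = (\<Prod>i\<in>A. \<Prod>j\<in>B. x j / (x j - q * x i))"
  proof (intro prod.cong refl)
    fix i j assume "i \<in> A" "j \<in> B"
    hence "i \<in> I" "j \<notin> I" using assms by auto
    thus "qshift q I x j / (qshift q I x j - qshift q I x i) = x j / (x j - q * x i)"
      by (simp add: qshift_def)
  qed
  finally show ?thesis
    unfolding ratio_prod_def pairing_def omega_def by (simp flip: prod.distrib)
qed

definition Mcoeff :: "(nat \<Rightarrow> 'a::field) \<Rightarrow> nat set \<Rightarrow> int \<Rightarrow> nat set \<Rightarrow> 'a" where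
  "Mcoeff x U n I = prod x I powi n * ratio_prod x I (U - I)"

text \<open>The separate clause for \<alpha> = 0 agrees with the general sum, which then has only
  the empty set with coefficient 1. Thus M_{\<alpha>-1,n} with \<alpha> = 1 is handled
  uniformly.\<close>

lemma Mop_eq_sum:
  "Mop q N \<alpha> n f x = (\<Sum>I\<in>Pow {..<N}. if card I = \<alpha> then Mcoeff x {..<N} n I * f (qshift q I x) else 0)"
proof (cases "\<alpha> = 0")
  case True
  have "qshift q {} x = x" by (simp add: qshift_def)
  thus ?thesis using True sum_Pow_card_0[of "{..<N}" "\<lambda>I. Mcoeff x {..<N} n I * f (qshift q I x)"]
    by (simp add: Mop_def Mcoeff_def ratio_prod_def)
next
  case False
  hence "Mop q N \<alpha> n f x =
      (\<Sum>I\<in>{I \<in> Pow {..<N}. card I = \<alpha>}. Mcoeff x {..<N} n I * f (qshift q I x))"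
    by (simp add: Mop_def Mcoeff_def ratio_prod_def Gamma_def)
  also have "\<dots> = (\<Sum>I\<in>Pow {..<N}. if card I = \<alpha> then Mcoeff x {..<N} n I * f (qshift q I x) else 0)"
    by (rule sum.inter_filter) simp
  finally show ?thesis .
qed

section \<open>Grouping pairs of subsets by overlap\<close>

lemma sum_pairs_by_overlap:
  fixes G :: "'i set \<Rightarrow> 'i set \<Rightarrow> 'b::comm_monoid_add"
  assumes "finite U"
  shows "(\<Sum>I\<in>Pow U. \<Sum>J\<in>Pow U. G I J) =
    (\<Sum>K\<in>Pow U. \<Sum>L\<in>Pow (U - K). \<Sum>A\<in>Pow L. G (K \<union> A) (K \<union> (L - A)))"
proof -
  have fin: "finite (Pow U)" "\<And>K. finite (Pow (U - K))" using assms by auto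
  have finL: "finite (Pow L)" if "L \<in> Pow (U - K)" for K L
    using that assms by (auto intro: finite_subset)
  have "(\<Sum>K\<in>Pow U. \<Sum>L\<in>Pow (U - K). \<Sum>A\<in>Pow L. G (K \<union> A) (K \<union> (L - A))) =
    (\<Sum>K\<in>Pow U. \<Sum>(L, A)\<in>Sigma (Pow (U - K)) Pow. G (K \<union> A) (K \<union> (L - A)))"
    by (intro sum.cong refl sum.Sigma fin ballI finL)
  also have "\<dots> = (\<Sum>(K, L, A)\<in>Sigma (Pow U) (\<lambda>K. Sigma (Pow (U - K)) Pow). G (K \<union> A) (K \<union> (L - A)))"
    using fin finL by (subst sum.Sigma) (auto intro!: finite_SigmaI simp: split_def)
  also have "\<dots> = (\<Sum>(I, J)\<in>Pow U \<times> Pow U. G I J)"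
  proof (rule sum.reindex_bij_witness[where
      i = "\<lambda>(I, J). (I \<inter> J, (I - J) \<union> (J - I), I - J)" and j = "\<lambda>(K, L, A). (K \<union> A, K \<union> (L - A))"])
    fix p assume "p \<in> Sigma (Pow U) (\<lambda>K. Sigma (Pow (U - K)) Pow)"
    then obtain K L A where p: "p = (K, L, A)" "K \<subseteq> U" "L \<subseteq> U - K" "A \<subseteq> L" by auto
    show "(case (case p of (K, L, A) \<Rightarrow> (K \<union> A, K \<union> (L - A))) of
        (I, J) \<Rightarrow> (I \<inter> J, (I - J) \<union> (J - I), I - J)) = p"
      unfolding p(1) prod.case prod.inject using p(2-) by blast
  next
    fix p assume "p \<in> Pow U \<times> Pow U"
    then obtain I J where p: "p = (I, J)" by (cases p)
    show "(case (case p of (I, J) \<Rightarrow> (I \<inter> J, (I - J) \<union> (J - I), I - J)) of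
        (K, L, A) \<Rightarrow> (K \<union> A, K \<union> (L - A))) = p"
      unfolding p prod.case prod.inject by blast
  qed auto
  also have "\<dots> = (\<Sum>I\<in>Pow U. \<Sum>J\<in>Pow U. G I J)" by (simp add: sum.cartesian_product)
  finally show ?thesis by simp
qed

text \<open>With B = L - A and Z outside K and L, the factors between K and L and between L and Z
  recombine to products that do not see the splitting: K and A are shifted together, and B and Z not
  at all. Only the pairs between A and B remain, with the monomials and the power of q from shifting
  x_K^m.\<close>

lemma Mcoeff_product:
  fixes x :: "nat \<Rightarrow> 'a::field"
  assumes fin: "finite U" and K: "K \<subseteq> U" and L: "L \<subseteq> U - K" and A: "A \<subseteq> L" and q: "q \<noteq> 0"
    and nz: "\<And>i. i \<in> U \<Longrightarrow> x i \<noteq> 0"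
  shows "Mcoeff x U n (K \<union> A) * Mcoeff (qshift q (K \<union> A) x) U m (K \<union> (L - A)) =
    (ratio_prod x K L * ratio_prod x K (U - K - L) * ratio_prod (qshift q K x) K (U - K - L)
       * ratio_prod x L (U - K - L) * prod x K powi (n + m)) *
    (q powi (m * int (card K)) * (prod x A powi n * prod x (L - A) powi m * pairing q x A (L - A)))"
proof -
  define B where "B = L - A"
  define Z where "Z = U - K - L"
  define y where "y = qshift q (K \<union> A) x"
  have f: "finite K" "finite A" "finite B" "finite Z"
    using fin K L A by (auto simp: B_def Z_def intro: finite_subset)
  have LAB: "L = A \<union> B" using A by (auto simp: B_def)
  have d: "K \<inter> A = {}" "K \<inter> B = {}" "A \<inter> B = {}" "Z \<inter> B = {}" "Z \<inter> A = {}" "Z \<inter> K = {}"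
    using L A by (auto simp: B_def Z_def)
  have U1: "U - (K \<union> A) = Z \<union> B" and U2: "U - (K \<union> B) = Z \<union> A"
    using K L A by (auto simp: B_def Z_def)
  have px: "prod x (K \<union> A) = prod x K * prod x A" using f d by (intro prod.union_disjoint)
  have "prod y K = q ^ card K * prod x K"
    by (simp add: y_def qshift_def prod.distrib)
  moreover have "prod y B = prod x B"
    using d by (intro prod.cong refl) (auto simp: y_def qshift_def)
  ultimately have py: "prod y (K \<union> B) = q ^ card K * prod x K * prod x B"
    using prod.union_disjoint[OF f(1,3) d(2), of y] by simp
  have r1: "ratio_prod x (K \<union> A) (Z \<union> B) =
     ratio_prod x K Z * ratio_prod x K B * (ratio_prod x A Z * ratio_prod x A B)"
    using f d by (simp add: ratio_prod_Un_left ratio_prod_Un_right)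
  have r2: "ratio_prod y (K \<union> B) (Z \<union> A) =
     ratio_prod y K Z * ratio_prod y K A * (ratio_prod y B Z * ratio_prod y B A)"
    using f d by (simp add: ratio_prod_Un_left ratio_prod_Un_right)
  have s1: "ratio_prod y K A = ratio_prod x K A"
    unfolding y_def using q by (intro ratio_prod_qshift_inside) auto
  have s2: "ratio_prod y B Z = ratio_prod x B Z"
    using d by (intro ratio_prod_cong) (auto simp: y_def qshift_def)
  have s3: "ratio_prod y K Z = ratio_prod (qshift q K x) K Z"
    using d by (intro ratio_prod_cong) (auto simp: y_def qshift_def)
  have s4: "ratio_prod x A B * ratio_prod y B A = pairing q x A B"
    unfolding y_def using d by (intro ratio_prod_pairing) auto
  have s5: "ratio_prod x K L = ratio_prod x K A * ratio_prod x K B"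
    unfolding LAB using f d by (intro ratio_prod_Un_right)
  have s6: "ratio_prod x L Z = ratio_prod x A Z * ratio_prod x B Z"
    unfolding LAB using f d by (intro ratio_prod_Un_left)
  have "prod x K \<noteq> 0" using f K nz by auto
  hence pw: "prod x K powi (n + m) = prod x K powi n * prod x K powi m" by (rule power_int_add[OF disjI1])
  have qp: "(q ^ card K) powi m = q powi (m * int (card K))"
    by (subst mult.commute) (simp add: power_int_mult)
  show ?thesis
    unfolding Mcoeff_def y_def[symmetric] B_def[symmetric] Z_def[symmetric] U1 U2 px py r1 r2 s1 s2 s3 s5 s6
      s4[symmetric] pw power_int_mult_distrib qp
    by (simp add: ac_simps)
qed

text \<open>The part of the composite belonging to (K, L) that depends on the orders and exponents
  separately; the power of q stays inside since it depends on m.\<close>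

definition overlap_sum :: "'a::field \<Rightarrow> (nat \<Rightarrow> 'a) \<Rightarrow> nat set \<Rightarrow> nat set \<Rightarrow> nat \<Rightarrow> nat \<Rightarrow> int \<Rightarrow> int \<Rightarrow> 'a" where
  "overlap_sum q x K L \<alpha> \<beta> n m = q powi (m * int (card K)) *
     (\<Sum>A\<in>Pow L. if card K + card A = \<alpha> \<and> card K + card (L - A) = \<beta>
        then prod x A powi n * prod x (L - A) powi m * pairing q x A (L - A) else 0)"

lemma overlap_sum_eq_0:
  assumes "\<And>A. A \<in> Pow L \<Longrightarrow> \<not> (card K + card A = \<alpha> \<and> card K + card (L - A) = \<beta>)"
  shows "overlap_sum q x K L \<alpha> \<beta> n m = 0"
  unfolding overlap_sum_def using assms by (subst sum.neutral) auto

text \<open>The coefficient \<open>c\<close> depends on the exponents only through their sum s and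
  not on the orders. In each relation all composites have equal s (2n + 1 or 2n), so the relation
  may be checked for each (K, L) alone.\<close>

lemma Mop_Mop_eq:
  fixes x :: "nat \<Rightarrow> 'a::field"
  assumes q: "q \<noteq> 0" and nz: "\<And>i. i < N \<Longrightarrow> x i \<noteq> 0"
  obtains c where "\<And>\<alpha> \<beta> n m. n + m = s \<Longrightarrow> Mop q N \<alpha> n (Mop q N \<beta> m f) x =
    (\<Sum>K\<in>Pow {..<N}. \<Sum>L\<in>Pow ({..<N} - K). c K L * overlap_sum q x K L \<alpha> \<beta> n m)"
proof -
  let ?U = "{..<N}"
  define c where "c = (\<lambda>K L. ratio_prod x K L * ratio_prod x K (?U - K - L)
     * ratio_prod (qshift q K x) K (?U - K - L)
     * ratio_prod x L (?U - K - L) * prod x K powi s * f (qshift q (K \<union> L) (qshift q K x)))"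
  have "Mop q N \<alpha> n (Mop q N \<beta> m f) x =
    (\<Sum>K\<in>Pow ?U. \<Sum>L\<in>Pow (?U - K). c K L * overlap_sum q x K L \<alpha> \<beta> n m)" if s: "n + m = s" for \<alpha> \<beta> n m
  proof -
    have "Mop q N \<alpha> n (Mop q N \<beta> m f) x = (\<Sum>I\<in>Pow ?U. \<Sum>J\<in>Pow ?U.
        if card I = \<alpha> \<and> card J = \<beta> then Mcoeff x ?U n I * Mcoeff (qshift q I x) ?U m J
          * f (qshift q J (qshift q I x)) else 0)"
      unfolding Mop_eq_sum by (intro sum.cong refl) (auto simp: sum_distrib_left mult.assoc intro!: sum.cong)
    also have "\<dots> = (\<Sum>K\<in>Pow ?U. \<Sum>L\<in>Pow (?U - K). \<Sum>A\<in>Pow L.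
        if card (K \<union> A) = \<alpha> \<and> card (K \<union> (L - A)) = \<beta> then Mcoeff x ?U n (K \<union> A)
           * Mcoeff (qshift q (K \<union> A) x) ?U m (K \<union> (L - A))
          * f (qshift q (K \<union> (L - A)) (qshift q (K \<union> A) x)) else 0)"
      by (rule sum_pairs_by_overlap) simp
    also have "\<dots> = (\<Sum>K\<in>Pow ?U. \<Sum>L\<in>Pow (?U - K). c K L * overlap_sum q x K L \<alpha> \<beta> n m)"
      unfolding overlap_sum_def sum_distrib_left
    proof (intro sum.cong refl)
      fix K L A assume KLA: "K \<in> Pow ?U" "L \<in> Pow (?U - K)" "A \<in> Pow L"
      hence f: "finite K" "finite A" "finite (L - A)" by (auto intro: finite_subset)
      have cards: "card (K \<union> A) = card K + card A" "card (K \<union> (L - A)) = card K + card (L - A)"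
        using f KLA by (auto intro!: card_Un_disjoint)
      \<comment> \<open>K is shifted twice and L once, however L is split.\<close>
      have sh: "qshift q (K \<union> (L - A)) (qshift q (K \<union> A) x) = qshift q (K \<union> L) (qshift q K x)"
        using KLA by (auto simp: qshift_def fun_eq_iff)
      have m: "Mcoeff x ?U n (K \<union> A) * Mcoeff (qshift q (K \<union> A) x) ?U m (K \<union> (L - A)) =
        (ratio_prod x K L * ratio_prod x K (?U - K - L) * ratio_prod (qshift q K x) K (?U - K - L)
           * ratio_prod x L (?U - K - L) * prod x K powi (n + m)) *
        (q powi (m * int (card K)) * (prod x A powi n * prod x (L - A) powi m * pairing q x A (L - A)))"
        using KLA q nz by (intro Mcoeff_product) auto
      show "(if card (K \<union> A) = \<alpha> \<and> card (K \<union> (L - A)) = \<beta> then Mcoeff x ?U n (K \<union> A)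
           * Mcoeff (qshift q (K \<union> A) x) ?U m (K \<union> (L - A))
          * f (qshift q (K \<union> (L - A)) (qshift q (K \<union> A) x)) else 0) =
        c K L * (q powi (m * int (card K)) * (if card K + card A = \<alpha> \<and> card K + card (L - A) = \<beta>
          then prod x A powi n * prod x (L - A) powi m * pairing q x A (L - A) else 0))"
        unfolding cards sh m c_def s by (simp add: ac_simps)
    qed
    finally show ?thesis .
  qed
  thus thesis by (rule that)
qed

section \<open>The two relations for a fixed overlap\<close>

lemma powi_Suc_left: "(x::'a::field) \<noteq> 0 \<Longrightarrow> x powi (n + 1) = x * x powi n"
  by (simp add: power_int_add)

lemma prod_nonzero_subset:
  fixes x :: "'i \<Rightarrow> 'a::field"
  assumes "finite L" "0 \<notin> x ` L" "A \<subseteq> L"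
  shows "prod x A \<noteq> 0"
  using assms finite_subset[OF assms(3,1)] by (force simp: prod_zero_iff)

lemma prod_powi_split:
  fixes x :: "'i \<Rightarrow> 'a::field"
  assumes "finite L" "A \<subseteq> L"
  shows "prod x A powi n * prod x (L - A) powi n = prod x L powi n"
  using prod.subset_diff[OF assms(2,1), of x] by (simp add: mult.commute flip: power_int_mult_distrib)

text \<open>If the sizes do not fit, both sums are empty. Otherwise subtracting |K| from both orders
  gives a and b. The larger exponent n + 1 on the left contributes q^|K|, which together with
  q^min(a, b) makes q^min(\<alpha>, \<beta>).\<close>

lemma overlap_sum_comm:
  fixes x :: "nat \<Rightarrow> 'a::field"
  assumes fin: "finite L" and q: "q \<noteq> 0" and inj: "inj_on x L" and nz: "0 \<notin> x ` L"
    and ne: "\<And>i j. i \<in> L \<Longrightarrow> j \<in> L \<Longrightarrow> i \<noteq> j \<Longrightarrow> x j \<noteq> q * x i"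
  shows "overlap_sum q x K L \<alpha> \<beta> n (n + 1) = q ^ min \<alpha> \<beta> * overlap_sum q x K L \<beta> \<alpha> (n + 1) n"
proof (cases "card K \<le> \<alpha> \<and> card K \<le> \<beta> \<and> card L = (\<alpha> - card K) + (\<beta> - card K)")
  case False
  have "\<not> (card K + card A = \<alpha> \<and> card K + card (L - A) = \<beta>)"
    "\<not> (card K + card A = \<beta> \<and> card K + card (L - A) = \<alpha>)" if "A \<in> Pow L" for A
    using card_Diff_eq[OF fin, of A] that False by auto
  note impossible = this
  show ?thesis by (simp only: overlap_sum_eq_0[OF impossible(1)] overlap_sum_eq_0[OF impossible(2)]
    mult_zero_right diff_self)
next
  case True
  define k a b where "k = card K" and "a = \<alpha> - k" and "b = \<beta> - k"
  have ab: "\<alpha> = k + a" "\<beta> = k + b" and cL: "card L = a + b"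
    using True by (auto simp: k_def a_def b_def)
  have nzs: "prod x A \<noteq> 0" if "A \<subseteq> L" for A
    using nz that by (rule prod_nonzero_subset[OF fin])
  have pl: "prod x A powi n * prod x (L - A) powi n = prod x L powi n" if "A \<subseteq> L" for A
    by (rule prod_powi_split[OF fin that])
  have e1: "overlap_sum q x K L \<alpha> \<beta> n (n + 1) = q powi (n * int k) * q ^ k * prod x L powi n *
     (\<Sum>A\<in>Pow L. if card A = a then prod x (L - A) * pairing q x A (L - A) else 0)"
  proof -
    have "(n + 1) * int k = n * int k + int k" by (simp add: algebra_simps)
    hence "q powi ((n + 1) * int (card K)) = q powi (n * int k) * q ^ k"
      using q by (simp add: power_int_add k_def)
    thus ?thesis unfolding overlap_sum_def mult.assoc[of _ "prod x L powi n"] sum_distrib_left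
    proof (simp only:, intro arg_cong2[where f = "(*)"] refl sum.cong)
      fix A assume "A \<in> Pow L"
      hence A: "A \<subseteq> L" by simp
      show "(if card K + card A = \<alpha> \<and> card K + card (L - A) = \<beta>
        then prod x A powi n * prod x (L - A) powi (n + 1) * pairing q x A (L - A) else 0) =
        prod x L powi n * (if card A = a then prod x (L - A) * pairing q x A (L - A) else 0)"
        using card_Diff_eq[OF fin A] cL ab nzs[of "L - A"] pl[OF A, symmetric]
        by (simp add: k_def powi_Suc_left)
    qed
  qed
  have e2: "overlap_sum q x K L \<beta> \<alpha> (n + 1) n = q powi (n * int k) * prod x L powi n *
     (\<Sum>A\<in>Pow L. if card A = b then prod x A * pairing q x A (L - A) else 0)"
  proof -
    show ?thesis unfolding overlap_sum_def mult.assoc[of _ "prod x L powi n"] sum_distrib_left k_def[symmetric]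
    proof (intro arg_cong2[where f = "(*)"] refl sum.cong)
      fix A assume "A \<in> Pow L"
      hence A: "A \<subseteq> L" by simp
      show "(if k + card A = \<beta> \<and> k + card (L - A) = \<alpha>
        then prod x A powi (n + 1) * prod x (L - A) powi n * pairing q x A (L - A) else 0) =
        prod x L powi n * (if card A = b then prod x A * pairing q x A (L - A) else 0)"
        using card_Diff_eq[OF fin A] cL ab nzs[of A] A pl[OF A, symmetric]
        by (simp add: powi_Suc_left)
    qed
  qed
  have "(\<Sum>A\<in>Pow L. if card A = a then prod x (L - A) * pairing q x A (L - A) else 0) =
     q ^ min a b * (\<Sum>A\<in>Pow L. if card A = b then prod x A * pairing q x A (L - A) else 0)"
    using splitsum_comm_weight[OF fin cL inj nz ne] unfolding splitsum_comm_weight_eq by simp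
  moreover have "min \<alpha> \<beta> = k + min a b" using ab by simp
  ultimately show ?thesis unfolding e1 e2 by (simp add: power_add)
qed

text \<open>All three sums require |L| = 2(\<alpha> - |K|). Once x_L^n and the common power of q are
  taken out, their combination is the split sum with \<open>quad_weight\<close>.\<close>

lemma overlap_sum_quad:
  fixes x :: "nat \<Rightarrow> 'a::field"
  assumes fin: "finite L" and q: "q \<noteq> 0" and inj: "inj_on x L" and nz: "0 \<notin> x ` L"
    and ne: "\<And>i j. i \<in> L \<Longrightarrow> j \<in> L \<Longrightarrow> i \<noteq> j \<Longrightarrow> x j \<noteq> q * x i" and \<alpha>: "1 \<le> \<alpha>"
  shows "q ^ \<alpha> * overlap_sum q x K L \<alpha> \<alpha> (n + 1) (n - 1) =
    overlap_sum q x K L \<alpha> \<alpha> n n - overlap_sum q x K L (\<alpha> + 1) (\<alpha> - 1) n n"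
proof (cases "card K \<le> \<alpha> \<and> card L = 2 * (\<alpha> - card K)")
  case False
  have "\<not> (card K + card A = \<alpha> \<and> card K + card (L - A) = \<alpha>)"
    "\<not> (card K + card A = \<alpha> + 1 \<and> card K + card (L - A) = \<alpha> - 1)" if "A \<in> Pow L" for A
    using card_Diff_eq[OF fin, of A] that False \<alpha> by auto
  note impossible = this
  show ?thesis by (simp only: overlap_sum_eq_0[OF impossible(1)] overlap_sum_eq_0[OF impossible(2)]
    mult_zero_right diff_self)
next
  case True
  define k a where "k = card K" and "a = \<alpha> - k"
  have a: "\<alpha> = k + a" and cL: "card L = 2 * a" using True by (auto simp: k_def a_def)
  have nzs: "prod x A \<noteq> 0" if "A \<subseteq> L" for A
    using nz that by (rule prod_nonzero_subset[OF fin])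
  have pl: "prod x A powi n * prod x (L - A) powi n = prod x L powi n" if "A \<subseteq> L" for A
    by (rule prod_powi_split[OF fin that])
  have "(n - 1) * int k = n * int k - int k" by (simp add: algebra_simps)
  hence "q powi ((n - 1) * int k) = q powi (n * int k) / q ^ k"
    using q by (simp add: power_int_diff)
  \<comment> \<open>The exponent n - 1 costs q^|K|, so of q^\<alpha> exactly the q^a in
    \<open>quad_weight\<close> remains.\<close>
  hence qk: "q ^ \<alpha> * q powi ((n - 1) * int k) = q powi (n * int k) * q ^ a"
    using q by (simp add: a power_add)
  have "overlap_sum q x K L \<alpha> \<alpha> n n - overlap_sum q x K L (\<alpha> + 1) (\<alpha> - 1) n n
      - q ^ \<alpha> * overlap_sum q x K L \<alpha> \<alpha> (n + 1) (n - 1) =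
    q powi (n * int k) * prod x L powi n * splitsum (quad_weight q a) q x L"
    unfolding overlap_sum_def k_def[symmetric] mult.assoc[of "q ^ \<alpha>", symmetric] qk
      mult.assoc[of "q powi (n * int k)"] right_diff_distrib[symmetric] splitsum_def
      sum_distrib_left sum_subtractf[symmetric]
  proof (intro arg_cong2[where f = "(*)"] refl sum.cong)
    fix A assume "A \<in> Pow L"
    hence A: "A \<subseteq> L" by simp
    have cA: "card A + card (L - A) = 2 * a" using card_Diff_eq[OF fin A] cL by simp
    have u: "prod x A powi (n + 1) * prod x (L - A) powi (n - 1) =
        prod x L powi n * (prod x A / prod x (L - A))"
      using nzs[of A] nzs[of "L - A"] A pl[OF A, symmetric] by (simp add: powi_Suc_left power_int_diff)
    have i1: "k + card A = \<alpha> \<and> k + card (L - A) = \<alpha> \<longleftrightarrow> card A = a" using cA a by auto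
    \<comment> \<open>Here \<open>\<alpha> - 1\<close> is truncated subtraction, exact because
      \<alpha> is at least 1.\<close>
    have i2: "k + card A = \<alpha> + 1 \<and> k + card (L - A) = \<alpha> - 1 \<longleftrightarrow> card A = Suc a" using cA a \<alpha> by auto
    show "(if k + card A = \<alpha> \<and> k + card (L - A) = \<alpha>
            then prod x A powi n * prod x (L - A) powi n * pairing q x A (L - A) else 0) -
          (if k + card A = \<alpha> + 1 \<and> k + card (L - A) = \<alpha> - 1
            then prod x A powi n * prod x (L - A) powi n * pairing q x A (L - A) else 0) -
          q ^ a * (if k + card A = \<alpha> \<and> k + card (L - A) = \<alpha>
            then prod x A powi (n + 1) * prod x (L - A) powi (n - 1) * pairing q x A (L - A) else 0) =
          prod x L powi n * (quad_weight q a (card A) (prod x A) (prod x (L - A)) * pairing q x A (L - A))"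
      unfolding i1 i2 u pl[OF A] quad_weight_def by (simp add: algebra_simps)
  qed
  also have "\<dots> = 0" using splitsum_quad_weight[OF fin cL inj nz ne] by simp
  finally show ?thesis by simp
qed

section \<open>Assembling the relations for the operators\<close>

lemma separated_points_subset:
  fixes x :: "nat \<Rightarrow> 'a::field"
  assumes nz: "\<forall>i<N. x i \<noteq> 0" and ne: "\<forall>i<N. \<forall>j<N. i \<noteq> j \<longrightarrow> x i \<noteq> x j \<and> q * x i \<noteq> x j"
    and L: "L \<in> Pow ({..<N} - K)"
  shows "finite L" "inj_on x L" "0 \<notin> x ` L"
    and "\<And>i j. i \<in> L \<Longrightarrow> j \<in> L \<Longrightarrow> i \<noteq> j \<Longrightarrow> x j \<noteq> q * x i"
proof -
  have lt: "i < N" if "i \<in> L" for i using that L by auto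
  show "finite L" using L by (auto intro: finite_subset)
  show "inj_on x L" using ne lt by (intro inj_onI) metis
  show "0 \<notin> x ` L" using nz lt by (metis imageE)
  show "x j \<noteq> q * x i" if "i \<in> L" "j \<in> L" "i \<noteq> j" for i j using ne lt that by metis
qed

theorem theorem4p2:
  fixes q :: "'a::field" and r :: nat
  defines "N \<equiv> Suc r"
  shows "(\<forall>(n::int) f x. Mop q N N n f x = (\<Prod>i<N. x i) powi n * Gamma q {..<N} f x)
   \<and> (\<forall>\<alpha> \<beta> (n::int) f x.
        \<alpha> \<in> {1..r} \<and> \<beta> \<in> {1..r} \<and> symmetric_fun N f \<and>
        q \<noteq> 0 \<and> (\<forall>i<N. x i \<noteq> 0) \<and> (\<forall>i<N. \<forall>j<N. i \<noteq> j \<longrightarrow> x i \<noteq> x j \<and> q * x i \<noteq> x j)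
        \<longrightarrow> Mop q N \<alpha> n (Mop q N \<beta> (n + 1) f) x
            = q ^ min \<alpha> \<beta> * Mop q N \<beta> (n + 1) (Mop q N \<alpha> n f) x)
   \<and> (\<forall>\<alpha> (n::int) f x.
        \<alpha> \<in> {1..r} \<and> symmetric_fun N f \<and>
        q \<noteq> 0 \<and> (\<forall>i<N. x i \<noteq> 0) \<and> (\<forall>i<N. \<forall>j<N. i \<noteq> j \<longrightarrow> x i \<noteq> x j \<and> q * x i \<noteq> x j)
        \<longrightarrow> q ^ \<alpha> * Mop q N \<alpha> (n + 1) (Mop q N \<alpha> (n - 1) f) x
            = Mop q N \<alpha> n (Mop q N \<alpha> n f) x - Mop q N (\<alpha> + 1) n (Mop q N (\<alpha> - 1) n f) x)"
proof (intro conjI allI impI)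
  fix n :: int and f x
  show "Mop q N N n f x = (\<Prod>i<N. x i) powi n * Gamma q {..<N} f x"
    \<comment> \<open>The only subset of full size is the whole index set, whose complement is
      empty, so the product of ratios is 1.\<close>
    using sum_Pow_card_full[of "{..<N}" "\<lambda>I. Mcoeff x {..<N} n I * f (qshift q I x)"]
    unfolding Mop_eq_sum by (simp add: Mcoeff_def ratio_prod_def Gamma_def)
next
  fix \<alpha> \<beta> :: nat and n :: int and f :: "(nat \<Rightarrow> 'a) \<Rightarrow> 'a" and x :: "nat \<Rightarrow> 'a"
  assume H: "\<alpha> \<in> {1..r} \<and> \<beta> \<in> {1..r} \<and> symmetric_fun N f \<and>
        q \<noteq> 0 \<and> (\<forall>i<N. x i \<noteq> 0) \<and> (\<forall>i<N. \<forall>j<N. i \<noteq> j \<longrightarrow> x i \<noteq> x j \<and> q * x i \<noteq> x j)"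
  obtain c where c: "\<And>\<alpha> \<beta> n' m. n' + m = n + (n + 1) \<Longrightarrow> Mop q N \<alpha> n' (Mop q N \<beta> m f) x =
    (\<Sum>K\<in>Pow {..<N}. \<Sum>L\<in>Pow ({..<N} - K). c K L * overlap_sum q x K L \<alpha> \<beta> n' m)"
    using Mop_Mop_eq[of q N x "n + (n + 1)" f] H by blast
  have "overlap_sum q x K L \<alpha> \<beta> n (n + 1) = q ^ min \<alpha> \<beta> * overlap_sum q x K L \<beta> \<alpha> (n + 1) n"
    if "L \<in> Pow ({..<N} - K)" for K L
    by (rule overlap_sum_comm) (use H separated_points_subset[OF _ _ that, of x q] in blast)+
  thus "Mop q N \<alpha> n (Mop q N \<beta> (n + 1) f) x = q ^ min \<alpha> \<beta> * Mop q N \<beta> (n + 1) (Mop q N \<alpha> n f) x"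
    by (simp add: c sum_distrib_left mult.left_commute)
next
  fix \<alpha> :: nat and n :: int and f :: "(nat \<Rightarrow> 'a) \<Rightarrow> 'a" and x :: "nat \<Rightarrow> 'a"
  assume H: "\<alpha> \<in> {1..r} \<and> symmetric_fun N f \<and>
        q \<noteq> 0 \<and> (\<forall>i<N. x i \<noteq> 0) \<and> (\<forall>i<N. \<forall>j<N. i \<noteq> j \<longrightarrow> x i \<noteq> x j \<and> q * x i \<noteq> x j)"
  \<comment> \<open>All three composites have exponent sum 2n, so one \<open>c\<close> serves them
    all.\<close>
  obtain c where c: "\<And>\<alpha> \<beta> n' m. n' + m = 2 * n \<Longrightarrow> Mop q N \<alpha> n' (Mop q N \<beta> m f) x =
    (\<Sum>K\<in>Pow {..<N}. \<Sum>L\<in>Pow ({..<N} - K). c K L * overlap_sum q x K L \<alpha> \<beta> n' m)"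
    using Mop_Mop_eq[of q N x "2 * n" f] H by blast
  have o: "q ^ \<alpha> * overlap_sum q x K L \<alpha> \<alpha> (n + 1) (n - 1) =
    overlap_sum q x K L \<alpha> \<alpha> n n - overlap_sum q x K L (\<alpha> + 1) (\<alpha> - 1) n n"
    if "L \<in> Pow ({..<N} - K)" for K L
    by (rule overlap_sum_quad) (use H separated_points_subset[OF _ _ that, of x q] in \<open>blast | simp\<close>)+
  have "q ^ \<alpha> * Mop q N \<alpha> (n + 1) (Mop q N \<alpha> (n - 1) f) x =
    (\<Sum>K\<in>Pow {..<N}. \<Sum>L\<in>Pow ({..<N} - K). c K L * (q ^ \<alpha> * overlap_sum q x K L \<alpha> \<alpha> (n + 1) (n - 1)))"
    by (subst c) (simp_all add: sum_distrib_left mult.left_commute)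
  also have "\<dots> = (\<Sum>K\<in>Pow {..<N}. \<Sum>L\<in>Pow ({..<N} - K).
      c K L * overlap_sum q x K L \<alpha> \<alpha> n n - c K L * overlap_sum q x K L (\<alpha> + 1) (\<alpha> - 1) n n)"
    by (intro sum.cong refl) (simp only: o right_diff_distrib)
  also have "\<dots> = Mop q N \<alpha> n (Mop q N \<alpha> n f) x - Mop q N (\<alpha> + 1) n (Mop q N (\<alpha> - 1) n f) x"
    by (simp add: c sum_subtractf)
  finally show "q ^ \<alpha> * Mop q N \<alpha> (n + 1) (Mop q N \<alpha> (n - 1) f) x =
    Mop q N \<alpha> n (Mop q N \<alpha> n f) x - Mop q N (\<alpha> + 1) n (Mop q N (\<alpha> - 1) n f) x" .
qed

end
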